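(* Let $m\ge 2$, let $k$ be a field, let $S=k[x_{ij}\mid 1\le i\le 2,\ 1\le j\le m]$, and let $<$ be any term order on $S$. Let $\Delta$ be a pure $1$-dimensional simplicial complex on the vertex set $[m]$ (i.e. a graph), with binomial edge ideal $J_\Delta=\big([a_1,a_2] \mid \{a_1<a_2\}\text{ an edge of }\Delta\big)\subseteq S$. Then being lcm-closed with respect to $<$ is not only sufficient but also necessary for the generators of $J_\Delta$ indexed by the facets of $\Delta$ to form a reduced Gröbner basis with respect to $<$; that is, the set $\{[a_1,a_2]\mid\{a_1<a_2\}\text{ an edge of }\Delta\}$ is a reduced Gröbner basis of $J_\Delta$ with respect to $<$ if and only if $J_\Delta$ is lcm-closed with respect to $<$.
   Context: Here $[m]=\{1,\dots,m\}$ and, for $1\le a_1<a_2\le m$, $[a_1,a_2]=x_{1a_1}x_{2a_2}-x_{1a_2}x_{2a_1}$ is the maximal minor of the generic $2\times m$ matrix $(x_{ij})$ on columns $a_1,a_2$. For any simplicial complex $\Delta'$ on $[m]$ of dimension at most $1$, $J_{\Delta'}$ is the ideal of $S$ generated by the minors $[a_1,a_2]$ with $\{a_1<a_2\}$ an edge of $\Delta'$ (zero if there are no edges). Maximal cliques: let $\mathcal S$ be the set of simplices $\Gamma$ with vertices in $[m]$, $\dim\Gamma\ge 1$, and whose $1$-skeleton $\Gamma^{(1)}$ (the subcomplex of faces of dimension at most $1$) is contained in $\Delta$. Let $\Gamma_1,\dots,\Gamma_c$ be the elements of $\mathcal S$ maximal under inclusion and $\Delta_i:=\Gamma_i^{(1)}$;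 then $\Delta=\Delta_1\cup\dots\cup\Delta_c$ is the maximal clique decomposition of $\Delta$. For a term order $<$, $\operatorname{in}_<(f)$ denotes the leading term of $f$. Lcm-closed: $J_\Delta$ is lcm-closed with respect to $<$ if the following holds for all $i,j$: for all $2$-minors $[\mathbf b]\in J_{\Delta_i}$ and $[\mathbf b']\in J_{\Delta_j}$ with non-coprime lead terms and with $[\mathbf b],[\mathbf b']\notin J_{\Delta_i\cap\Delta_j}$, there exists a $2$-minor $[\mathbf d]\in J_{\Delta_i\cap\Delta_j}$ such that $\operatorname{in}_<([\mathbf d])$ divides $\operatorname{lcm}\big(\operatorname{in}_<([\mathbf b]),\operatorname{in}_<([\mathbf b'])\big)$. *)

theory Defs
  imports "HOL-Library.Poly_Mapping" "HOL-Algebra.Ideal"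
begin

section \<open>The polynomial ring of a generic two-row matrix\<close>

text \<open>The variable \<open>x\<^sub>i\<^sub>j\<close> is the pair \<open>(i, j)\<close>; a monomial is its exponent vector, so the product
  of monomials is \<open>+\<close> and the monomial \<open>1\<close> is \<open>0\<close>. Polynomials in \<open>x\<^sub>i\<^sub>j\<close> with \<open>i \<le> 2\<close>, \<open>j \<le> m\<close>
  are cut out of the polynomials in all variables by a carrier set. The \<open>linorder\<close> instance that
  the library puts on exponent vectors plays no role here: term orders are explicit relations.\<close>

type_synonym mono = "(nat \<times> nat) \<Rightarrow>\<^sub>0 nat"
type_synonym 'k poly = "mono \<Rightarrow>\<^sub>0 'k"

definition monomials :: "nat \<Rightarrow> mono set" where
  "monomials m = {t. Poly_Mapping.keys t \<subseteq> {1..2} \<times> {1..m}}"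

definition poly_ring :: "nat \<Rightarrow> 'k::field poly ring" where
  "poly_ring m = \<lparr>carrier = {p. Poly_Mapping.keys p \<subseteq> monomials m},
     monoid.mult = (*), one = 1, ring.zero = 0, add = (+)\<rparr>"

lemma monomials_add: "s \<in> monomials m \<Longrightarrow> t \<in> monomials m \<Longrightarrow> s + t \<in> monomials m"
  using Poly_Mapping.keys_add[of s t] by (auto simp: monomials_def)

lemma cring_poly_ring: "cring (poly_ring m :: 'k::field poly ring)"
proof (rule cringI)
  show "abelian_group (poly_ring m :: 'k poly ring)"
  proof (rule abelian_groupI)
    fix x :: "'k poly" assume "x \<in> carrier (poly_ring m)"
    then show "\<exists>y\<in>carrier (poly_ring m). y \<oplus>\<^bsub>poly_ring m\<^esub> x = \<zero>\<^bsub>poly_ring m\<^esub>"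
      by (intro bexI[of _ "- x"]) (auto simp: poly_ring_def)
  qed (use Poly_Mapping.keys_add in \<open>fastforce simp: poly_ring_def add.assoc add.commute\<close>)+
  show "Group.comm_monoid (poly_ring m :: 'k poly ring)"
  proof (rule comm_monoidI)
    fix x y :: "'k poly"
    assume "x \<in> carrier (poly_ring m)" "y \<in> carrier (poly_ring m)"
    then show "x \<otimes>\<^bsub>poly_ring m\<^esub> y \<in> carrier (poly_ring m)"
      using keys_mult[of x y] monomials_add by (fastforce simp: poly_ring_def)
  qed (auto simp: poly_ring_def monomials_def mult.assoc mult.commute)
qed (auto simp: poly_ring_def distrib_right)

definition X :: "nat \<Rightarrow> nat \<Rightarrow> 'k::field poly" where
  "X i j = Poly_Mapping.single (Poly_Mapping.single (i, j) 1) 1"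

definition minor :: "nat \<Rightarrow> nat \<Rightarrow> 'k::field poly" where
  "minor a b = X 1 a * X 2 b - X 1 b * X 2 a"

definition minors :: "nat \<Rightarrow> 'k::field poly set" where
  "minors m = {minor a b | a b. 1 \<le> a \<and> a < b \<and> b \<le> m}"


section \<open>Term orders and Groebner bases\<close>

definition mono_dvd :: "mono \<Rightarrow> mono \<Rightarrow> bool" where
  "mono_dvd s t \<longleftrightarrow> (\<exists>u. t = s + u)"

definition mono_coprime :: "mono \<Rightarrow> mono \<Rightarrow> bool" where
  "mono_coprime s t \<longleftrightarrow> Poly_Mapping.keys s \<inter> Poly_Mapping.keys t = {}"

text \<open>Subtraction of exponents is truncated, so \<open>s + (t - s)\<close> is the pointwise maximum.\<close>

definition mono_lcm :: "mono \<Rightarrow> mono \<Rightarrow> mono" where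
  "mono_lcm s t = s + (t - s)"

lemma lookup_mono_lcm:
  "Poly_Mapping.lookup (mono_lcm s t) v = max (Poly_Mapping.lookup s v) (Poly_Mapping.lookup t v)"
  by (simp add: mono_lcm_def lookup_add lookup_minus)

text \<open>A term order on the ring in \<open>2 \<times> m\<close> variables; \<open>lt\<close> is unconstrained on other monomials.\<close>

definition term_order :: "nat \<Rightarrow> (mono \<Rightarrow> mono \<Rightarrow> bool) \<Rightarrow> bool" where
  "term_order m lt \<longleftrightarrow>
     irreflp_on (monomials m) lt \<and> transp_on (monomials m) lt \<and> totalp_on (monomials m) lt \<and>
     (\<forall>t\<in>monomials m. t \<noteq> 0 \<longrightarrow> lt 0 t) \<and>
     (\<forall>s\<in>monomials m. \<forall>t\<in>monomials m. \<forall>u\<in>monomials m. lt s t \<longrightarrow> lt (s + u) (t + u))"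

definition lead_mono :: "(mono \<Rightarrow> mono \<Rightarrow> bool) \<Rightarrow> 'k::field poly \<Rightarrow> mono" where
  "lead_mono lt p =
     (THE t. t \<in> Poly_Mapping.keys p \<and> (\<forall>s\<in>Poly_Mapping.keys p. s \<noteq> t \<longrightarrow> lt s t))"

definition lead_term :: "(mono \<Rightarrow> mono \<Rightarrow> bool) \<Rightarrow> 'k::field poly \<Rightarrow> 'k poly" where
  "lead_term lt p =
     Poly_Mapping.single (lead_mono lt p) (Poly_Mapping.lookup p (lead_mono lt p))"

definition initial_ideal ::
    "nat \<Rightarrow> (mono \<Rightarrow> mono \<Rightarrow> bool) \<Rightarrow> 'k::field poly set \<Rightarrow> 'k poly set" where
  "initial_ideal m lt I = Idl\<^bsub>poly_ring m\<^esub> (lead_term lt ` (I - {0}))"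

definition groebner_basis ::
    "nat \<Rightarrow> (mono \<Rightarrow> mono \<Rightarrow> bool) \<Rightarrow> 'k::field poly set \<Rightarrow> 'k poly set \<Rightarrow> bool" where
  "groebner_basis m lt G I \<longleftrightarrow>
     finite G \<and> G \<subseteq> I \<and> 0 \<notin> G \<and>
     Idl\<^bsub>poly_ring m\<^esub> (lead_term lt ` G) = initial_ideal m lt I"

text \<open>Leading coefficients are not normalised to \<open>1\<close>: the leading coefficient of a minor is \<open>1\<close> or
  \<open>-1\<close> depending on the term order, so minors are monic only up to sign.\<close>

definition reduced_groebner_basis ::
    "nat \<Rightarrow> (mono \<Rightarrow> mono \<Rightarrow> bool) \<Rightarrow> 'k::field poly set \<Rightarrow> 'k poly set \<Rightarrow> bool" where
  "reduced_groebner_basis m lt G I \<longleftrightarrow>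
     groebner_basis m lt G I \<and>
     (\<forall>g\<in>G. \<forall>h\<in>G. g \<noteq> h \<longrightarrow>
        (\<forall>t\<in>Poly_Mapping.keys h. \<not> mono_dvd (lead_mono lt g) t))"


section \<open>Simplicial complexes, binomial edge ideals and the maximal clique decomposition\<close>

text \<open>Complexes contain the empty face.\<close>

definition simplicial_complex :: "nat set \<Rightarrow> nat set set \<Rightarrow> bool" where
  "simplicial_complex V D \<longleftrightarrow>
     {} \<in> D \<and> \<Union>D = V \<and> (\<forall>F\<in>D. finite F) \<and> (\<forall>F\<in>D. \<forall>G. G \<subseteq> F \<longrightarrow> G \<in> D)"

definition facets :: "nat set set \<Rightarrow> nat set set" where
  "facets D = {F \<in> D. \<forall>G\<in>D. F \<subseteq> G \<longrightarrow> G = F}"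

definition pure_of_dim :: "nat \<Rightarrow> nat set set \<Rightarrow> bool" where
  "pure_of_dim d D \<longleftrightarrow> (\<forall>F\<in>facets D. card F = d + 1)"

definition skeleton1 :: "nat set set \<Rightarrow> nat set set" where
  "skeleton1 D = {F \<in> D. card F \<le> 2}"

definition edge_minors :: "nat set set \<Rightarrow> 'k::field poly set" where
  "edge_minors D = {minor a b | a b. a < b \<and> {a, b} \<in> D}"

definition edge_ideal :: "nat \<Rightarrow> nat set set \<Rightarrow> 'k::field poly set" where
  "edge_ideal m D = Idl\<^bsub>poly_ring m\<^esub> (edge_minors D)"

text \<open>The simplex with vertex set \<open>W\<close> is the complex \<open>Pow W\<close>.\<close>

definition clique_simplices :: "nat \<Rightarrow> nat set set \<Rightarrow> nat set set set" where
  "clique_simplices m D =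
     {Pow W | W. W \<subseteq> {1..m} \<and> card W \<ge> 2 \<and> skeleton1 (Pow W) \<subseteq> D}"

definition clique_decomposition :: "nat \<Rightarrow> nat set set \<Rightarrow> nat set set set" where
  "clique_decomposition m D =
     skeleton1 ` {C \<in> clique_simplices m D. \<forall>C'\<in>clique_simplices m D. C \<subseteq> C' \<longrightarrow> C' = C}"

text \<open>The type argument is the coefficient field, which occurs in no other argument.\<close>

definition lcm_closed ::
    "'k::field itself \<Rightarrow> nat \<Rightarrow> (mono \<Rightarrow> mono \<Rightarrow> bool) \<Rightarrow> nat set set \<Rightarrow> bool" where
  "lcm_closed _ m lt D \<longleftrightarrow>
     (\<forall>D1\<in>clique_decomposition m D. \<forall>D2\<in>clique_decomposition m D.
      \<forall>b\<in>(minors m :: 'k poly set) \<inter> edge_ideal m D1.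
      \<forall>b'\<in>(minors m :: 'k poly set) \<inter> edge_ideal m D2.
        \<not> mono_coprime (lead_mono lt b) (lead_mono lt b') \<and>
        b \<notin> edge_ideal m (D1 \<inter> D2) \<and> b' \<notin> edge_ideal m (D1 \<inter> D2) \<longrightarrow>
        (\<exists>d\<in>(minors m :: 'k poly set) \<inter> edge_ideal m (D1 \<inter> D2).
           mono_dvd (lead_mono lt d) (mono_lcm (lead_mono lt b) (lead_mono lt b'))))"

end

theory Submission
  imports Defs "HOL-Library.Confluence"
begin

text \<open>Both sides of the equivalence say the same thing about the graph \<open>\<Delta>\<close>. Comparing the two
  terms of each minor \<open>[a, b]\<close> orders the columns: put \<open>a \<prec> b\<close> if \<open>x\<^sub>1\<^sub>b x\<^sub>2\<^sub>a < x\<^sub>1\<^sub>a x\<^sub>2\<^sub>b\<close>. This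
  is a strict linear order (\<open>precedes_strict_linear_order\<close>), and the minor of \<open>a \<prec> b\<close> has leading
  monomial \<open>x\<^sub>1\<^sub>a x\<^sub>2\<^sub>b\<close>; so an arbitrary term order behaves like a diagonal one after renumbering the
  columns. Call \<open>\<Delta>\<close> closed if any two distinct neighbours of a vertex \<open>a\<close> that lie on the same side
  of \<open>a\<close> with respect to \<open>\<prec>\<close> are adjacent. Each side of the equivalence amounts to \<open>\<Delta>\<close> being closed.

  Lcm-closedness (\<open>lcm_closed_iff_fork_closed\<close>): two distinct leading monomials \<open>x\<^sub>1\<^sub>a x\<^sub>2\<^sub>b\<close> and
  \<open>x\<^sub>1\<^sub>c x\<^sub>2\<^sub>d\<close> have a common factor exactly if the edges share the smaller or share the larger
  endpoint. Let \<open>{a, b}\<close> and \<open>{a, d}\<close> be edges of this kind in two maximal cliques whose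
  intersection contains neither edge. Then it contains neither \<open>b\<close> nor \<open>d\<close>, but a leading monomial
  dividing the lcm involves one of them; so the minor demanded by the definition does not exist, and
  lcm-closedness means that no such configuration occurs. If \<open>b\<close> and \<open>d\<close> are not
  adjacent, extending both edges to maximal cliques produces one. Conversely it could occur with \<open>b\<close>
  and \<open>d\<close> adjacent; that a closed graph excludes this as well is the combinatorial core,
  \<open>fork_closed_no_crossing_cliques\<close>.

  Groebner basis (\<open>groebner_basis_iff_fork_closed\<close>): if the neighbours \<open>b, d\<close> of \<open>a\<close> violate
  closedness, the S-polynomial of \<open>[a, b]\<close> and \<open>[a, d]\<close> is \<open>x\<^sub>i\<^sub>a [b, d]\<close> up to sign, with \<open>i = 2\<close> for
  a smaller \<open>a\<close> and \<open>i = 1\<close> for a larger one, and no leading monomial of a generator divides its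
  leading monomial. If \<open>\<Delta>\<close> is closed, replacing \<open>x\<^sub>1\<^sub>a x\<^sub>2\<^sub>b\<close> by \<open>x\<^sub>1\<^sub>b x\<^sub>2\<^sub>a\<close> inside a monomial along edges
  \<open>a \<prec> b\<close> is a confluent rewriting (\<open>swap_step_confluent\<close>), so an irreducible monomial is the
  smallest one in its class modulo the binomials of the edges. In an element of the ideal the
  coefficients of each class add up to zero, so its leading monomial is not the smallest one in its
  class and hence is reducible.

  Reducedness costs nothing, since no term of a minor divides a term of a different minor.\<close>

section \<open>Polynomials supported on prescribed monomials and ideals\<close>

lemma genideal_poly_ring_induct [consumes 2, case_names gen zero add mult]:
  fixes S :: "'k::field poly set"
  assumes "p \<in> Idl\<^bsub>poly_ring m\<^esub> S" and "S \<subseteq> carrier (poly_ring m)"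
    and gen: "\<And>s. s \<in> S \<Longrightarrow> P s"
    and zero: "P 0"
    and add: "\<And>p q. P p \<Longrightarrow> P q \<Longrightarrow> P (p + q)"
    and mult: "\<And>p q. P p \<Longrightarrow> P (q * p)"
  shows "P p"
proof -
  interpret R: cring "poly_ring m :: 'k poly ring" by (rule cring_poly_ring)
  let ?I = "{p \<in> carrier (poly_ring m). P p}"
  have "ideal ?I (poly_ring m)"
  proof (rule idealI)
    show "ring (poly_ring m :: 'k poly ring)" by (rule R.ring_axioms)
    show "subgroup ?I (add_monoid (poly_ring m))"
    proof (rule R.add.subgroupI)
      show "?I \<noteq> {}" using zero by (auto simp: poly_ring_def intro!: exI[of _ 0])
    next
      fix a assume a: "a \<in> ?I"
      have "\<ominus>\<^bsub>poly_ring m\<^esub> a = (- 1) * a"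
        using a by (intro R.minus_equality) (auto simp: poly_ring_def)
      with a show "\<ominus>\<^bsub>poly_ring m\<^esub> a \<in> ?I"
        using mult[of a "- 1"] R.a_inv_closed[of a] by auto
    next
      fix a b assume "a \<in> ?I" "b \<in> ?I"
      then show "a \<oplus>\<^bsub>poly_ring m\<^esub> b \<in> ?I"
        using add[of a b] R.a_closed[of a b] by (auto simp: poly_ring_def)
    qed auto
  next
    fix a x assume "a \<in> ?I" "x \<in> carrier (poly_ring m :: 'k poly ring)"
    then show "x \<otimes>\<^bsub>poly_ring m\<^esub> a \<in> ?I" "a \<otimes>\<^bsub>poly_ring m\<^esub> x \<in> ?I"
      using mult[of a x] R.m_closed[of a x] R.m_closed[of x a]
      by (auto simp: poly_ring_def mult.commute)
  qed
  moreover have "S \<subseteq> ?I" using assms(2) gen by auto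
  ultimately have "Idl\<^bsub>poly_ring m\<^esub> S \<subseteq> ?I" by (rule R.genideal_minimal)
  with assms(1) show ?thesis by auto
qed

text \<open>The locale facts about ideals, restated with the operations of the type of polynomials.\<close>

lemma genideal_poly_ring_mult:
  fixes p q :: "'k::field poly"
  assumes "S \<subseteq> carrier (poly_ring m)" "p \<in> Idl\<^bsub>poly_ring m\<^esub> S" "q \<in> carrier (poly_ring m)"
  shows "q * p \<in> Idl\<^bsub>poly_ring m\<^esub> S"
proof -
  interpret R: cring "poly_ring m :: 'k poly ring" by (rule cring_poly_ring)
  interpret I: ideal "Idl\<^bsub>poly_ring m\<^esub> S" "poly_ring m" by (rule R.genideal_ideal[OF assms(1)])
  show ?thesis using I.I_l_closed[OF assms(2,3)] by (simp add: poly_ring_def)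
qed

lemma genideal_poly_ring_add:
  fixes p q :: "'k::field poly"
  assumes "S \<subseteq> carrier (poly_ring m)" "p \<in> Idl\<^bsub>poly_ring m\<^esub> S" "q \<in> Idl\<^bsub>poly_ring m\<^esub> S"
  shows "p + q \<in> Idl\<^bsub>poly_ring m\<^esub> S"
proof -
  interpret R: cring "poly_ring m :: 'k poly ring" by (rule cring_poly_ring)
  interpret I: ideal "Idl\<^bsub>poly_ring m\<^esub> S" "poly_ring m" by (rule R.genideal_ideal[OF assms(1)])
  show ?thesis using I.a_closed[OF assms(2,3)] by (simp add: poly_ring_def)
qed

lemma genideal_poly_ring_self:
  fixes S :: "'k::field poly set"
  assumes "S \<subseteq> carrier (poly_ring m)"
  shows "S \<subseteq> Idl\<^bsub>poly_ring m\<^esub> S"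
proof -
  interpret R: cring "poly_ring m :: 'k poly ring" by (rule cring_poly_ring)
  show ?thesis by (rule R.genideal_self[OF assms])
qed

lemma genideal_poly_ring_subset:
  fixes S :: "'k::field poly set"
  assumes "S \<subseteq> carrier (poly_ring m)" "T \<subseteq> Idl\<^bsub>poly_ring m\<^esub> S"
  shows "Idl\<^bsub>poly_ring m\<^esub> T \<subseteq> Idl\<^bsub>poly_ring m\<^esub> S"
proof -
  interpret R: cring "poly_ring m :: 'k poly ring" by (rule cring_poly_ring)
  show ?thesis by (rule R.genideal_minimal[OF R.genideal_ideal[OF assms(1)] assms(2)])
qed

lemma genideal_poly_ring_carrier:
  fixes S :: "'k::field poly set"
  assumes "S \<subseteq> carrier (poly_ring m)"
  shows "Idl\<^bsub>poly_ring m\<^esub> S \<subseteq> carrier (poly_ring m)"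
proof -
  interpret R: cring "poly_ring m :: 'k poly ring" by (rule cring_poly_ring)
  interpret I: ideal "Idl\<^bsub>poly_ring m\<^esub> S" "poly_ring m" by (rule R.genideal_ideal[OF assms])
  show ?thesis by (rule I.a_subset)
qed

text \<open>With \<open>A\<close> the multiples of some terms this describes monomial ideals; with \<open>A\<close> the
  non-divisors of a fixed monomial it shows that this monomial does not occur in an ideal.\<close>

lemma genideal_keys_subset:
  fixes S :: "'k::field poly set"
  assumes "p \<in> Idl\<^bsub>poly_ring m\<^esub> S" and "S \<subseteq> carrier (poly_ring m)"
    and gen: "\<And>s. s \<in> S \<Longrightarrow> Poly_Mapping.keys s \<subseteq> A"
    and up: "\<And>t u. t \<in> A \<Longrightarrow> u + t \<in> A"
  shows "Poly_Mapping.keys p \<subseteq> A"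
  using assms(1,2)
proof (induction rule: genideal_poly_ring_induct)
  case (add p q)
  then show ?case using Poly_Mapping.keys_add[of p q] by auto
next
  case (mult p q)
  then show ?case using keys_mult[of q p] up by fastforce
qed (use gen in auto)

definition weighted_sum :: "(mono \<Rightarrow> 'k) \<Rightarrow> 'k::field poly \<Rightarrow> 'k" where
  "weighted_sum F p = (\<Sum>t\<in>Poly_Mapping.keys p. Poly_Mapping.lookup p t * F t)"

lemma weighted_sum_superset:
  assumes "finite A" "Poly_Mapping.keys p \<subseteq> A"
  shows "weighted_sum F p = (\<Sum>t\<in>A. Poly_Mapping.lookup p t * F t)"
  unfolding weighted_sum_def using assms
  by (intro sum.mono_neutral_left) (auto simp: in_keys_iff)

lemma weighted_sum_zero [simp]: "weighted_sum F 0 = 0"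
  by (simp add: weighted_sum_def)

lemma weighted_sum_add: "weighted_sum F (p + q) = weighted_sum F p + weighted_sum F q"
proof -
  let ?A = "Poly_Mapping.keys p \<union> Poly_Mapping.keys q"
  have *: "weighted_sum F r = (\<Sum>t\<in>?A. Poly_Mapping.lookup r t * F t)"
    if "Poly_Mapping.keys r \<subseteq> ?A" for r using that by (intro weighted_sum_superset) auto
  show ?thesis
    using Poly_Mapping.keys_add[of p q]
    by (simp add: * lookup_add distrib_right sum.distrib)
qed

lemma weighted_sum_single [simp]: "weighted_sum F (Poly_Mapping.single t c) = c * F t"
  by (cases "c = 0") (simp_all add: weighted_sum_def)

lemma poly_induct [case_names zero add_single]:
  fixes p :: "'k::field poly"
  assumes "P 0" and "\<And>p t c. P p \<Longrightarrow> P (p + Poly_Mapping.single t c)"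
  shows "P p"
proof (induction p rule: update_induct)
  case (update p t c)
  have "Poly_Mapping.update t c p = p + Poly_Mapping.single t c"
    using update by (intro poly_mapping_eqI)
      (auto simp: lookup_update lookup_add lookup_single when_def in_keys_iff)
  with assms(2) update show ?case by metis
qed (rule assms(1))

lemma weighted_sum_single_mult:
  "weighted_sum F (Poly_Mapping.single u c * p) = c * weighted_sum (\<lambda>t. F (u + t)) p"
proof (induction p rule: poly_induct)
  case (add_single p t d)
  then show ?case by (simp add: distrib_left weighted_sum_add mult_single mult.assoc)
qed simp

text \<open>A pairing that sees only the classes of a translation-invariant relation annihilates the
  ideal as soon as it annihilates the generators: a translate of the weight is again constant on
  classes, which gives closure under multiplication by monomials.\<close>

lemma weighted_sum_genideal_eq_zero:
  fixes S :: "'k::field poly set" and step :: "mono \<Rightarrow> mono \<Rightarrow> bool"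
  assumes "p \<in> Idl\<^bsub>poly_ring m\<^esub> S" and "S \<subseteq> carrier (poly_ring m)"
    and gen: "\<And>s F. s \<in> S \<Longrightarrow> (\<And>t t'. step t t' \<Longrightarrow> F t = F t') \<Longrightarrow> weighted_sum F s = 0"
    and translate: "\<And>t t' u. step t t' \<Longrightarrow> step (u + t) (u + t')"
    and inv: "\<And>t t'. step t t' \<Longrightarrow> F t = F t'"
  shows "weighted_sum F p = 0"
proof -
  have "\<forall>F. (\<forall>t t'. step t t' \<longrightarrow> F t = F t') \<longrightarrow> weighted_sum F p = 0"
    using assms(1,2)
  proof (induction rule: genideal_poly_ring_induct)
    case (mult p q)
    show ?case
    proof (intro allI impI)
      fix F :: "mono \<Rightarrow> 'k" assume F: "\<forall>t t'. step t t' \<longrightarrow> F t = F t'"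
      show "weighted_sum F (q * p) = 0"
      proof (induction q rule: poly_induct)
        case (add_single q u c)
        have "weighted_sum (\<lambda>t. F (u + t)) p = 0"
          using mult F translate[of _ _ u] by simp
        with add_single show ?case
          by (simp add: distrib_right weighted_sum_add weighted_sum_single_mult)
      qed simp
    qed
  next
    case (gen s)
    then show ?case using assms(3) by simp
  next
    case (add p q)
    then show ?case by (simp add: weighted_sum_add)
  qed simp
  with inv show ?thesis by simp
qed


section \<open>Leading monomials\<close>

lemma lead_mono_eqI:
  assumes "term_order m lt" "Poly_Mapping.keys p \<subseteq> monomials m" "t \<in> Poly_Mapping.keys p"
    and "\<And>s. s \<in> Poly_Mapping.keys p \<Longrightarrow> s \<noteq> t \<Longrightarrow> lt s t"
  shows "lead_mono lt p = t"
  unfolding lead_mono_def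
proof (rule the_equality)
  fix s assume s: "s \<in> Poly_Mapping.keys p \<and> (\<forall>s'\<in>Poly_Mapping.keys p. s' \<noteq> s \<longrightarrow> lt s' s)"
  show "s = t"
  proof (rule ccontr)
    assume "s \<noteq> t"
    then have "lt s t" "lt t s" "s \<in> monomials m" "t \<in> monomials m"
      using s assms(2,3,4) by auto
    then show False
      using assms(1) unfolding term_order_def by (meson irreflp_onD transp_onD)
  qed
qed (use assms in auto)

lemma lead_mono_greatest:
  fixes p :: "'k::field poly"
  assumes "term_order m lt" "Poly_Mapping.keys p \<subseteq> monomials m" "p \<noteq> 0"
  shows "lead_mono lt p \<in> Poly_Mapping.keys p"
    and "\<And>s. s \<in> Poly_Mapping.keys p \<Longrightarrow> s \<noteq> lead_mono lt p \<Longrightarrow> lt s (lead_mono lt p)"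
proof -
  have "Poly_Mapping.keys p \<noteq> {}" using assms(3) by simp
  moreover have "transp_on (Poly_Mapping.keys p) lt" "totalp_on (Poly_Mapping.keys p) lt"
    using assms(1,2) unfolding term_order_def by (meson transp_on_subset totalp_on_subset)+
  ultimately obtain t where t: "t \<in> Poly_Mapping.keys p"
      "\<forall>s\<in>Poly_Mapping.keys p. s \<noteq> t \<longrightarrow> lt s t"
    using Finite_Set.bex_greatest_element[of "Poly_Mapping.keys p" lt] by auto
  then have "lead_mono lt p = t" using assms(1,2) by (intro lead_mono_eqI) auto
  with t show "lead_mono lt p \<in> Poly_Mapping.keys p"
    "\<And>s. s \<in> Poly_Mapping.keys p \<Longrightarrow> s \<noteq> lead_mono lt p \<Longrightarrow> lt s (lead_mono lt p)" by auto
qed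

lemma mono_dvd_iff:
  "mono_dvd s t \<longleftrightarrow> (\<forall>v. Poly_Mapping.lookup s v \<le> Poly_Mapping.lookup t v)"
proof
  assume "\<forall>v. Poly_Mapping.lookup s v \<le> Poly_Mapping.lookup t v"
  then have "t = s + (t - s)"
    by (intro poly_mapping_eqI) (simp add: lookup_add lookup_minus del: split_paired_All)
  then show "mono_dvd s t" unfolding mono_dvd_def by blast
qed (auto simp: mono_dvd_def lookup_add)

lemma mono_dvd_refl: "mono_dvd t t"
  by (simp add: mono_dvd_iff)

lemma mono_dvd_add: "mono_dvd s t \<Longrightarrow> mono_dvd s (u + t)"
  by (auto simp: mono_dvd_iff lookup_add trans_le_add2)

text \<open>An ideal generated by terms contains only polynomials each of whose monomials is divisible
  by one of these terms; so equality of the two initial ideals comes down to divisibility of leading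
  monomials.\<close>

lemma groebner_basis_iff_lead_mono_dvd:
  fixes G I :: "'k::field poly set"
  assumes order: "term_order m lt" and fin: "finite G" and sub: "G \<subseteq> I" and nz: "0 \<notin> G"
    and I: "I \<subseteq> carrier (poly_ring m)"
  shows "groebner_basis m lt G I \<longleftrightarrow>
    (\<forall>f\<in>I - {0}. \<exists>g\<in>G. mono_dvd (lead_mono lt g) (lead_mono lt f))"
proof -
  have lead: "lead_mono lt f \<in> Poly_Mapping.keys f" "lead_mono lt f \<in> monomials m"
    if "f \<in> I - {0}" for f
    using lead_mono_greatest(1)[OF order, of f] that I by (auto simp: poly_ring_def)
  have keys: "Poly_Mapping.keys (lead_term lt f) = {lead_mono lt f}" if "f \<in> I - {0}" for f
    using lead[OF that] by (simp add: lead_term_def in_keys_iff)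
  have carr: "lead_term lt ` (I - {0}) \<subseteq> carrier (poly_ring m)"
    using lead keys by (auto simp: poly_ring_def)
  have G: "G \<subseteq> I - {0}" using sub nz by auto
  then have carrG: "lead_term lt ` G \<subseteq> carrier (poly_ring m)" using carr by blast
  show ?thesis
  proof
    assume gb: "groebner_basis m lt G I"
    show "\<forall>f\<in>I - {0}. \<exists>g\<in>G. mono_dvd (lead_mono lt g) (lead_mono lt f)"
    proof
      fix f assume f: "f \<in> I - {0}"
      have "lead_term lt f \<in> Idl\<^bsub>poly_ring m\<^esub> (lead_term lt ` G)"
        using gb genideal_poly_ring_self[OF carr] f
        unfolding groebner_basis_def initial_ideal_def by auto
      then have "Poly_Mapping.keys (lead_term lt f) \<subseteq> {t. \<exists>g\<in>G. mono_dvd (lead_mono lt g) t}"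
      proof (rule genideal_keys_subset[OF _ carrG])
        fix s assume "s \<in> lead_term lt ` G"
        then obtain g where g: "g \<in> G" "s = lead_term lt g" by blast
        then have "Poly_Mapping.keys s = {lead_mono lt g}" using keys G by blast
        then show "Poly_Mapping.keys s \<subseteq> {t. \<exists>g\<in>G. mono_dvd (lead_mono lt g) t}"
          using g(1) mono_dvd_refl by auto
      qed (auto intro: mono_dvd_add)
      then show "\<exists>g\<in>G. mono_dvd (lead_mono lt g) (lead_mono lt f)" using keys[OF f] by simp
    qed
  next
    assume dvd: "\<forall>f\<in>I - {0}. \<exists>g\<in>G. mono_dvd (lead_mono lt g) (lead_mono lt f)"
    have "lead_term lt ` (I - {0}) \<subseteq> Idl\<^bsub>poly_ring m\<^esub> (lead_term lt ` G)"
    proof (intro image_subsetI)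
      fix f assume f: "f \<in> I - {0}"
      then obtain g u where g: "g \<in> G" and u: "lead_mono lt f = lead_mono lt g + u"
        using dvd unfolding mono_dvd_def by blast
      define q :: "'k poly" where "q = Poly_Mapping.single u
        (Poly_Mapping.lookup f (lead_mono lt f) / Poly_Mapping.lookup g (lead_mono lt g))"
      have "Poly_Mapping.lookup g (lead_mono lt g) \<noteq> 0"
        using lead(1)[of g] g G by (auto simp: in_keys_iff)
      then have "lead_term lt f = q * lead_term lt g"
        by (simp add: q_def lead_term_def mult_single u add.commute)
      moreover have "Poly_Mapping.keys u \<subseteq> Poly_Mapping.keys (lead_mono lt f)"
        by (auto simp: u in_keys_iff lookup_add)
      then have "q \<in> carrier (poly_ring m)"
        using lead(2)[OF f] by (auto simp: q_def poly_ring_def monomials_def)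
      moreover have "lead_term lt g \<in> Idl\<^bsub>poly_ring m\<^esub> (lead_term lt ` G)"
        using genideal_poly_ring_self[OF carrG] g by blast
      ultimately show "lead_term lt f \<in> Idl\<^bsub>poly_ring m\<^esub> (lead_term lt ` G)"
        using genideal_poly_ring_mult[OF carrG] by metis
    qed
    then have "initial_ideal m lt I \<subseteq> Idl\<^bsub>poly_ring m\<^esub> (lead_term lt ` G)"
      unfolding initial_ideal_def by (rule genideal_poly_ring_subset[OF carrG])
    moreover have "Idl\<^bsub>poly_ring m\<^esub> (lead_term lt ` G) \<subseteq> initial_ideal m lt I"
      unfolding initial_ideal_def
      by (intro genideal_poly_ring_subset[OF carr]
          order_trans[OF image_mono[OF G] genideal_poly_ring_self[OF carr]])
    ultimately show "groebner_basis m lt G I"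
      unfolding groebner_basis_def using fin sub nz by auto
  qed
qed


section \<open>Minors and the linear order of the columns\<close>

text \<open>The monomial \<open>x\<^sub>1\<^sub>a x\<^sub>2\<^sub>b\<close>, which is on the diagonal of the minor on columns \<open>a, b\<close> and on
  the antidiagonal of the minor on columns \<open>b, a\<close>.\<close>

definition diag :: "nat \<Rightarrow> nat \<Rightarrow> mono" where
  "diag a b = Poly_Mapping.single (1, a) 1 + Poly_Mapping.single (2, b) 1"

lemma lookup_diag:
  "Poly_Mapping.lookup (diag a b) (i, e) = (if i = 1 \<and> e = a \<or> i = 2 \<and> e = b then 1 else 0)"
  by (auto simp: diag_def lookup_add lookup_single when_def)

lemma keys_diag: "Poly_Mapping.keys (diag a b) = {(1, a), (2, b)}"
  by (auto simp: in_keys_iff lookup_diag split: if_splits)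

lemma diag_eq_iff [simp]: "diag a b = diag c d \<longleftrightarrow> a = c \<and> b = d"
proof
  assume "diag a b = diag c d"
  then have "{(1, a), (2, b)} = {(1::nat, c), (2, d)}" by (metis keys_diag)
  then show "a = c \<and> b = d" by (simp add: doubleton_eq_iff)
qed simp

lemma diag_dvd_iff:
  "mono_dvd (diag a b) t \<longleftrightarrow>
    1 \<le> Poly_Mapping.lookup t (1, a) \<and> 1 \<le> Poly_Mapping.lookup t (2, b)"
  by (auto simp: mono_dvd_iff lookup_diag)

lemma diag_dvd_diag_iff: "mono_dvd (diag a b) (diag c d) \<longleftrightarrow> a = c \<and> b = d"
  by (auto simp: diag_dvd_iff lookup_diag)

lemma diag_in_monomials: "a \<in> {1..m} \<Longrightarrow> b \<in> {1..m} \<Longrightarrow> diag a b \<in> monomials m"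
  by (auto simp: monomials_def keys_diag)

lemma diag_add_exchange: "diag a b + diag c d = diag c b + diag a d"
  by (simp add: diag_def ac_simps)

lemma minor_eq:
  "(minor a b :: 'k::field poly) =
     Poly_Mapping.single (diag a b) 1 - Poly_Mapping.single (diag b a) 1"
  by (simp add: minor_def X_def mult_single diag_def)

lemma minor_swap: "(minor b a :: 'k::field poly) = - minor a b"
  by (simp add: minor_eq)

lemma keys_minor:
  "a \<noteq> b \<Longrightarrow> Poly_Mapping.keys (minor a b :: 'k::field poly) = {diag a b, diag b a}"
  by (auto simp: minor_eq in_keys_iff lookup_minus lookup_single when_def split: if_splits)

lemma weighted_sum_minor: "weighted_sum F (minor a b) = F (diag a b) - F (diag b a)"
proof -
  have "minor a b = Poly_Mapping.single (diag a b) 1 + Poly_Mapping.single (diag b a) (- 1 :: 'a)"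
    by (simp add: minor_eq single_uminus)
  then show ?thesis by (simp add: weighted_sum_add)
qed

lemma minor_in_carrier:
  "a \<in> {1..m} \<Longrightarrow> b \<in> {1..m} \<Longrightarrow> (minor a b :: 'k::field poly) \<in> carrier (poly_ring m)"
  by (cases "a = b") (auto simp: poly_ring_def keys_minor diag_in_monomials, simp add: minor_def)

definition precedes :: "(mono \<Rightarrow> mono \<Rightarrow> bool) \<Rightarrow> nat \<Rightarrow> nat \<Rightarrow> bool" where
  "precedes lt a b \<longleftrightarrow> lt (diag b a) (diag a b)"

text \<open>Transitivity comes from multiplying the two comparisons: the product of
  \<open>x\<^sub>1\<^sub>b x\<^sub>2\<^sub>a < x\<^sub>1\<^sub>a x\<^sub>2\<^sub>b\<close> and \<open>x\<^sub>1\<^sub>c x\<^sub>2\<^sub>b < x\<^sub>1\<^sub>b x\<^sub>2\<^sub>c\<close> has the common factor \<open>x\<^sub>1\<^sub>b x\<^sub>2\<^sub>b\<close>.\<close>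

lemma precedes_strict_linear_order:
  assumes order: "term_order m lt"
  shows "irreflp_on {1..m} (precedes lt)" "transp_on {1..m} (precedes lt)"
    "totalp_on {1..m} (precedes lt)"
proof -
  have irr: "\<not> lt t t" if "t \<in> monomials m" for t
    using order that unfolding term_order_def by (auto dest: irreflp_onD)
  have tr: "lt s u" if "lt s t" "lt t u" "s \<in> monomials m" "t \<in> monomials m" "u \<in> monomials m"
    for s t u using order that unfolding term_order_def by (meson transp_onD)
  have tot: "lt s t \<or> lt t s" if "s \<noteq> t" "s \<in> monomials m" "t \<in> monomials m" for s t
    using order that unfolding term_order_def totalp_on_def by metis
  have plus: "lt (s + u) (t + u)"
    if "lt s t" "s \<in> monomials m" "t \<in> monomials m" "u \<in> monomials m" for s t u
    using order that unfolding term_order_def by blast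
  show "irreflp_on {1..m} (precedes lt)"
    using irr diag_in_monomials by (auto simp: irreflp_on_def precedes_def)
  show "totalp_on {1..m} (precedes lt)"
    using tot diag_in_monomials by (auto simp: totalp_on_def precedes_def)
  show "transp_on {1..m} (precedes lt)"
  proof (rule transp_onI)
    fix a b c assume V: "a \<in> {1..m}" "b \<in> {1..m}" "c \<in> {1..m}"
      and ab: "precedes lt a b" and bc: "precedes lt b c"
    note mem = diag_in_monomials[OF V(1) V(2)] diag_in_monomials[OF V(2) V(1)]
      diag_in_monomials[OF V(1) V(3)] diag_in_monomials[OF V(3) V(1)]
      diag_in_monomials[OF V(2) V(3)] diag_in_monomials[OF V(3) V(2)]
      diag_in_monomials[OF V(2) V(2)]
    have "lt (diag b a + diag c b) (diag a b + diag c b)"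
      using ab mem by (intro plus) (auto simp: precedes_def)
    moreover have "lt (diag a b + diag c b) (diag b c + diag a b)"
      unfolding add.commute[of "diag a b" "diag c b"]
      using bc mem by (intro plus) (auto simp: precedes_def)
    ultimately have less: "lt (diag b a + diag c b) (diag b c + diag a b)"
      by (rule tr) (use mem monomials_add in blast)+
    have L: "diag b a + diag c b = diag c a + diag b b"
      by (rule diag_add_exchange)
    have R: "diag b c + diag a b = diag a c + diag b b"
      by (rule diag_add_exchange)
    have "a \<noteq> c" using less irr mem L R by (auto simp: monomials_add)
    moreover have "\<not> lt (diag a c) (diag c a)"
    proof
      assume "lt (diag a c) (diag c a)"
      then have "lt (diag a c + diag b b) (diag c a + diag b b)" using mem by (intro plus)
      then have "lt (diag a c + diag b b) (diag a c + diag b b)"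
        using less[unfolded L R] by (rule tr) (use mem monomials_add in blast)+
      then show False using irr mem by (auto simp: monomials_add)
    qed
    ultimately show "precedes lt a c"
      unfolding precedes_def using tot[of "diag a c" "diag c a"] mem by auto
  qed
qed

lemma lead_mono_minor:
  assumes "term_order m lt" "a \<in> {1..m}" "b \<in> {1..m}" "precedes lt a b"
  shows "lead_mono lt (minor a b :: 'k::field poly) = diag a b"
    "lead_mono lt (minor b a :: 'k::field poly) = diag a b"
proof -
  have "a \<noteq> b" using precedes_strict_linear_order(1)[OF assms(1)] assms by (auto dest: irreflp_onD)
  then show "lead_mono lt (minor a b :: 'k poly) = diag a b"
    "lead_mono lt (minor b a :: 'k poly) = diag a b"
    using assms diag_in_monomials
    by (auto simp: keys_minor precedes_def intro!: lead_mono_eqI[OF assms(1)])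
qed

text \<open>The set of minors lists each pair of columns once, by their numbers, while leading monomials
  depend on the term order. The next two lemmas translate between the two orientations, which
  differ by a sign.\<close>

lemma minors_orient:
  assumes "term_order m lt" "p \<in> (minors m :: 'k::field poly set)"
  obtains a b where "a \<in> {1..m}" "b \<in> {1..m}" "precedes lt a b" "a \<noteq> b"
    "p = minor a b \<or> p = minor b a" "lead_mono lt p = diag a b"
proof -
  obtain c d where cd: "1 \<le> c" "c < d" "d \<le> m" "p = minor c d"
    using assms(2) by (auto simp: minors_def)
  then have V: "c \<in> {1..m}" "d \<in> {1..m}" "c \<noteq> d" by auto
  then consider "precedes lt c d" | "precedes lt d c"
    using precedes_strict_linear_order(3)[OF assms(1)] by (metis totalp_onD)
  then show thesis
  proof cases
    case 1
    then show thesis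
      using that[of c d] V cd(4) lead_mono_minor(1)[OF assms(1) V(1,2) 1] by simp
  next
    case 2
    then show thesis
      using that[of d c] V cd(4) lead_mono_minor(2)[OF assms(1) V(2,1) 2] by simp
  qed
qed

lemma minors_unorient:
  assumes "a \<in> {1..m}" "b \<in> {1..m}" "a \<noteq> b"
  obtains p where "p \<in> (minors m :: 'k::field poly set)" "p = minor a b \<or> p = minor b a"
proof (cases "a < b")
  case True
  then have "(minor a b :: 'k poly) \<in> minors m" using assms by (auto simp: minors_def)
  then show thesis using that by blast
next
  case False
  then have "b < a" using assms by simp
  then have "(minor b a :: 'k poly) \<in> minors m" using assms by (auto simp: minors_def)
  then show thesis using that by blast
qed


section \<open>Edges, cliques and forks\<close>

definition adj :: "nat set set \<Rightarrow> nat \<Rightarrow> nat \<Rightarrow> bool" where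
  "adj D a b \<longleftrightarrow> a \<noteq> b \<and> {a, b} \<in> D"

lemma adj_sym: "adj D a b \<Longrightarrow> adj D b a"
  by (auto simp: adj_def insert_commute)

lemma adj_vertices: "\<Union>D \<subseteq> V \<Longrightarrow> adj D a b \<Longrightarrow> a \<in> V \<and> b \<in> V"
  by (auto simp: adj_def)

lemma edge_minors_carrier:
  assumes "\<Union>D \<subseteq> {1..m}"
  shows "(edge_minors D :: 'k::field poly set) \<subseteq> carrier (poly_ring m)"
  using assms by (auto simp: edge_minors_def intro!: minor_in_carrier)

text \<open>If \<open>{a, b}\<close> is no edge, no monomial of a generator divides \<open>x\<^sub>1\<^sub>a x\<^sub>2\<^sub>b\<close>, and this
  survives passing to the ideal; but \<open>x\<^sub>1\<^sub>a x\<^sub>2\<^sub>b\<close> occurs in the minor.\<close>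

lemma minor_in_edge_ideal_iff:
  assumes D: "\<Union>D \<subseteq> {1..m}" and "a \<noteq> b"
  shows "(minor a b :: 'k::field poly) \<in> edge_ideal m D \<longleftrightarrow> {a, b} \<in> D"
proof
  assume "(minor a b :: 'k poly) \<in> edge_ideal m D"
  show "{a, b} \<in> D"
  proof (rule ccontr)
    assume nD: "{a, b} \<notin> D"
    have "Poly_Mapping.keys (minor a b :: 'k poly) \<subseteq> {t. \<not> mono_dvd t (diag a b)}"
    proof (rule genideal_keys_subset)
      show "(minor a b :: 'k poly) \<in> Idl\<^bsub>poly_ring m\<^esub> (edge_minors D)"
        using \<open>minor a b \<in> edge_ideal m D\<close> by (simp add: edge_ideal_def)
      show "(edge_minors D :: 'k poly set) \<subseteq> carrier (poly_ring m)"
        by (rule edge_minors_carrier[OF D])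
      fix s :: "'k poly" assume "s \<in> edge_minors D"
      then obtain c d where "s = minor c d" "c < d" "{c, d} \<in> D" by (auto simp: edge_minors_def)
      then show "Poly_Mapping.keys s \<subseteq> {t. \<not> mono_dvd t (diag a b)}"
        using nD by (auto simp: keys_minor diag_dvd_diag_iff insert_commute)
    next
      fix t u assume "t \<in> {t. \<not> mono_dvd t (diag a b)}"
      then show "u + t \<in> {t. \<not> mono_dvd t (diag a b)}"
        by (auto simp: mono_dvd_iff lookup_add) (metis add_leD2)
    qed
    then show False using \<open>a \<noteq> b\<close> by (auto simp: keys_minor mono_dvd_iff)
  qed
next
  assume E: "{a, b} \<in> D"
  have carr: "(edge_minors D :: 'k poly set) \<subseteq> carrier (poly_ring m)"
    by (rule edge_minors_carrier[OF D])
  show "(minor a b :: 'k poly) \<in> edge_ideal m D"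
  proof (cases "a < b")
    case True
    with E show ?thesis
      using genideal_poly_ring_self[OF carr] by (auto simp: edge_ideal_def edge_minors_def)
  next
    case False
    with E \<open>a \<noteq> b\<close> have "b < a" "{b, a} \<in> D" by (auto simp: insert_commute)
    then have "(minor b a :: 'k poly) \<in> edge_minors D" by (auto simp: edge_minors_def)
    then have "(minor b a :: 'k poly) \<in> edge_ideal m D"
      using genideal_poly_ring_self[OF carr] by (auto simp: edge_ideal_def)
    then have "(- 1) * (minor b a :: 'k poly) \<in> edge_ideal m D"
      unfolding edge_ideal_def
      by (rule genideal_poly_ring_mult[OF carr]) (auto simp: poly_ring_def monomials_def)
    then show ?thesis by (subst minor_swap) simp
  qed
qed

text \<open>If \<open>R\<close> is a linear order of the vertices, the condition for \<open>R\<close> and for its converse together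
  is that of a closed graph in the theory of binomial edge ideals.\<close>

definition fork_closed :: "(nat \<Rightarrow> nat \<Rightarrow> bool) \<Rightarrow> (nat \<Rightarrow> nat \<Rightarrow> bool) \<Rightarrow> bool" where
  "fork_closed R E \<longleftrightarrow> (\<forall>a b c. R a b \<and> R a c \<and> E a b \<and> E a c \<and> b \<noteq> c \<longrightarrow> E b c)"

lemma fork_closedD:
  "fork_closed R E \<Longrightarrow> R a b \<Longrightarrow> R a c \<Longrightarrow> E a b \<Longrightarrow> E a c \<Longrightarrow> b \<noteq> c \<Longrightarrow> E b c"
  unfolding fork_closed_def by blast

definition is_clique :: "(nat \<Rightarrow> nat \<Rightarrow> bool) \<Rightarrow> nat set \<Rightarrow> bool" where
  "is_clique E W \<longleftrightarrow> (\<forall>u\<in>W. \<forall>v\<in>W. u \<noteq> v \<longrightarrow> E u v)"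

definition maximal_clique :: "nat set \<Rightarrow> (nat \<Rightarrow> nat \<Rightarrow> bool) \<Rightarrow> nat set \<Rightarrow> bool" where
  "maximal_clique V E W \<longleftrightarrow> W \<subseteq> V \<and> is_clique E W \<and>
     (\<forall>W'. W \<subseteq> W' \<and> W' \<subseteq> V \<and> is_clique E W' \<longrightarrow> W' = W)"

lemma clique_extends_to_maximal:
  assumes "finite V" "U \<subseteq> V" "is_clique E U"
  obtains W where "U \<subseteq> W" "maximal_clique V E W"
proof -
  let ?C = "{W. U \<subseteq> W \<and> W \<subseteq> V \<and> is_clique E W}"
  have fin: "finite ?C" by (rule finite_subset[of _ "Pow V"]) (use assms(1) in auto)
  have "U \<in> ?C" using assms by auto
  from finite_has_maximal2[OF fin this]
  obtain W where W: "W \<in> ?C" and max: "\<forall>W'\<in>?C. W \<subseteq> W' \<longrightarrow> W = W'" by auto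
  have "maximal_clique V E W"
    unfolding maximal_clique_def
  proof (intro conjI allI impI)
    fix W' assume "W \<subseteq> W' \<and> W' \<subseteq> V \<and> is_clique E W'"
    then show "W' = W" using W max by auto
  qed (use W in auto)
  then show thesis using that[of W] W by simp
qed

lemma maximal_clique_nonneighbour:
  assumes "maximal_clique V E W" "v \<in> V" "v \<notin> W" and sym: "\<And>a b. E a b \<Longrightarrow> E b a"
  obtains u where "u \<in> W" "\<not> E v u"
proof -
  have "\<not> is_clique E (insert v W)"
    using assms(1-3) unfolding maximal_clique_def by (metis insertI1 insert_subset subset_insertI)
  moreover have "is_clique E W" using assms(1) by (simp add: maximal_clique_def)
  ultimately have "\<exists>u\<in>W. \<not> E v u"
    using sym unfolding is_clique_def by (metis insert_iff)
  then show thesis using that by auto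
qed

text \<open>By maximality the first clique contains a non-neighbour \<open>e\<close> of \<open>d\<close> and the second a
  non-neighbour \<open>f\<close> of \<open>b\<close>. Closedness at \<open>a\<close> forces both below \<open>a\<close>, as a larger \<open>e\<close> would be
  adjacent to \<open>d\<close> and a larger \<open>f\<close> to \<open>b\<close>. Being smaller neighbours of \<open>a\<close>, they are adjacent by
  the converse condition. Closedness at the smaller of the two now produces one of the missing
  edges: at \<open>e\<close> the edge from \<open>b\<close> to \<open>f\<close>, at \<open>f\<close> the edge from \<open>d\<close> to \<open>e\<close>.\<close>

lemma fork_closed_no_crossing_cliques:
  assumes trans: "transp_on V R" and total: "totalp_on V R"
    and sym: "\<And>a b. E a b \<Longrightarrow> E b a"
    and closed: "fork_closed R E" "fork_closed R\<inverse>\<inverse> E"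
    and W: "maximal_clique V E W\<^sub>1" "maximal_clique V E W\<^sub>2"
    and a: "a \<in> W\<^sub>1" "a \<in> W\<^sub>2" and b: "b \<in> W\<^sub>1" "b \<notin> W\<^sub>2" and d: "d \<in> W\<^sub>2" "d \<notin> W\<^sub>1"
    and R: "R a b" "R a d"
  shows False
proof -
  have sub: "W\<^sub>1 \<subseteq> V" "W\<^sub>2 \<subseteq> V" using W by (auto simp: maximal_clique_def)
  have E1: "E u v" if "u \<in> W\<^sub>1" "v \<in> W\<^sub>1" "u \<noteq> v" for u v
    using W(1) that by (auto simp: maximal_clique_def is_clique_def)
  have E2: "E u v" if "u \<in> W\<^sub>2" "v \<in> W\<^sub>2" "u \<noteq> v" for u v
    using W(2) that by (auto simp: maximal_clique_def is_clique_def)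
  have cmp: "R u v \<or> R v u" if "u \<in> V" "v \<in> V" "u \<noteq> v" for u v
    using totalp_onD[OF total] that by blast
  have tr: "R u w" if "R u v" "R v w" "u \<in> V" "v \<in> V" "w \<in> V" for u v w
    using transp_onD[OF trans] that by blast
  have V: "a \<in> V" "b \<in> V" "d \<in> V" using a b d sub by auto
  have ne: "a \<noteq> b" "a \<noteq> d" "b \<noteq> d" using a b d by auto
  have bd: "E b d" using fork_closedD[OF closed(1) R] E1 E2 a b d ne by blast
  obtain e where e: "e \<in> W\<^sub>1" "\<not> E d e"
    using maximal_clique_nonneighbour[OF W(1) _ _ sym] d sub by blast
  obtain f where f: "f \<in> W\<^sub>2" "\<not> E b f"
    using maximal_clique_nonneighbour[OF W(2) _ _ sym] b sub by blast
  have e_ne: "e \<noteq> a" "e \<noteq> b" "e \<noteq> d" using e E2 a d ne bd sym by blast+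
  have f_ne: "f \<noteq> a" "f \<noteq> d" "f \<noteq> b" using f E1 a b ne bd by blast+
  have "e \<noteq> f" using E1[of b e] b e f e_ne by auto
  have Rea: "R e a"
  proof (rule ccontr)
    assume "\<not> R e a"
    then have "R a e" using cmp[of e a] e sub V e_ne by auto
    then show False using fork_closedD[OF closed(1) R(2)] E1 E2 a d e ne e_ne by metis
  qed
  have Rfa: "R f a"
  proof (rule ccontr)
    assume "\<not> R f a"
    then have "R a f" using cmp[of f a] f sub V f_ne by auto
    then show False using fork_closedD[OF closed(1) R(1)] E1 E2 a b f ne f_ne by metis
  qed
  have ef: "E e f"
    using fork_closedD[OF closed(2), of a e f] Rea Rfa E1 E2 a e f e_ne f_ne \<open>e \<noteq> f\<close> by auto
  have Reb: "R e b" and Rfd: "R f d"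
    using tr[OF Rea R(1)] tr[OF Rfa R(2)] V e(1) f(1) sub by auto
  have "R e f \<or> R f e" using cmp[of e f] e(1) f(1) sub \<open>e \<noteq> f\<close> by auto
  then show False
  proof
    assume "R e f"
    then have "E b f"
      using fork_closedD[OF closed(1) Reb, of f] ef E1 b e e_ne f_ne by auto
    with f show False by blast
  next
    assume "R f e"
    then have "E d e"
      using fork_closedD[OF closed(1) Rfd, of e] ef sym E2 d f e_ne f_ne by auto
    with e show False by blast
  qed
qed

lemma edge_in_skeleton1 [simp]: "{a, b} \<in> skeleton1 (Pow W) \<longleftrightarrow> a \<in> W \<and> b \<in> W"
  by (auto simp: skeleton1_def card_insert_if)

lemma skeleton1_Pow_Int: "skeleton1 (Pow W) \<inter> skeleton1 (Pow W') = skeleton1 (Pow (W \<inter> W'))"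
  by (auto simp: skeleton1_def)

lemma skeleton1_subset_iff_clique:
  assumes "simplicial_complex {1..m} D" "W \<subseteq> {1..m}"
  shows "skeleton1 (Pow W) \<subseteq> D \<longleftrightarrow> is_clique (adj D) W"
proof
  assume "skeleton1 (Pow W) \<subseteq> D"
  then show "is_clique (adj D) W"
    using edge_in_skeleton1 by (fastforce simp: is_clique_def adj_def)
next
  assume cl: "is_clique (adj D) W"
  show "skeleton1 (Pow W) \<subseteq> D"
  proof
    fix F assume F: "F \<in> skeleton1 (Pow W)"
    then have "F \<subseteq> W" "card F \<le> 2" "finite F"
      using assms(2) finite_subset[of F "{1..m}"] by (auto simp: skeleton1_def)
    then consider "F = {}" | u where "F = {u}" | u v where "F = {u, v}" "u \<noteq> v"
      by (metis card_0_eq card_1_singletonE card_2_iff le_Suc_eq le_zero_eq numeral_2_eq_2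
          One_nat_def)
    then show "F \<in> D"
    proof cases
      case 1
      then show ?thesis using assms(1) by (auto simp: simplicial_complex_def)
    next
      case (2 u)
      then have "u \<in> \<Union>D" using \<open>F \<subseteq> W\<close> assms by (auto simp: simplicial_complex_def)
      then obtain H where "H \<in> D" "{u} \<subseteq> H" by auto
      then show ?thesis using assms(1) 2 unfolding simplicial_complex_def by metis
    next
      case (3 u v)
      then show ?thesis using cl \<open>F \<subseteq> W\<close> by (auto simp: is_clique_def adj_def)
    qed
  qed
qed

text \<open>Inclusion of simplices is inclusion of their vertex sets, so maximal simplices with
  1-skeleton in the complex are maximal cliques of the graph. The bound on the cardinality drops
  isolated vertices.\<close>

lemma clique_decomposition_eq:
  assumes "simplicial_complex {1..m} D"
  shows "clique_decomposition m D =
    {skeleton1 (Pow W) | W. maximal_clique {1..m} (adj D) W \<and> 2 \<le> card W}"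
proof -
  have Pow_eq: "Pow W = Pow W' \<longleftrightarrow> W = W'" for W W' :: "nat set" by blast
  have mem: "Pow W \<in> clique_simplices m D \<longleftrightarrow>
      W \<subseteq> {1..m} \<and> 2 \<le> card W \<and> is_clique (adj D) W" for W
    using skeleton1_subset_iff_clique[OF assms] by (auto simp: clique_simplices_def Pow_eq)
  have pow: "\<exists>W. C = Pow W" if "C \<in> clique_simplices m D" for C
    using that by (auto simp: clique_simplices_def)
  have card: "2 \<le> card W'" if "2 \<le> card W" "W \<subseteq> W'" "W' \<subseteq> {1..m}" for W W' :: "nat set"
    using that by (meson card_mono finite_atLeastAtMost finite_subset order_trans)
  have "Pow W \<in> clique_simplices m D \<and> (\<forall>C'\<in>clique_simplices m D. Pow W \<subseteq> C' \<longrightarrow> C' = Pow W)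
      \<longleftrightarrow> maximal_clique {1..m} (adj D) W \<and> 2 \<le> card W" (is "?L \<longleftrightarrow> ?R") for W
  proof
    assume L: ?L
    show ?R
      unfolding maximal_clique_def
    proof (intro conjI allI impI)
      fix W' assume W': "W \<subseteq> W' \<and> W' \<subseteq> {1..m} \<and> is_clique (adj D) W'"
      moreover from this have "2 \<le> card W'" using L card[of W W'] by (simp add: mem)
      ultimately have "Pow W' \<in> clique_simplices m D" by (simp add: mem)
      moreover have "Pow W \<subseteq> Pow W'" using W' by (simp add: Pow_mono)
      ultimately have "Pow W' = Pow W" using L by simp
      then show "W' = W" by (simp only: Pow_eq)
    qed (use L in \<open>simp_all add: mem\<close>)
  next
    assume R: ?R
    show ?L
    proof (intro conjI ballI impI)
      show "Pow W \<in> clique_simplices m D" using R by (simp add: mem maximal_clique_def)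
      fix C' assume C': "C' \<in> clique_simplices m D" "Pow W \<subseteq> C'"
      then obtain W' where W': "C' = Pow W'" using pow by blast
      with C' have "W \<subseteq> W'" "W' \<subseteq> {1..m}" "is_clique (adj D) W'" by (auto simp: mem)
      with R have "W' = W" by (simp add: maximal_clique_def)
      with W' show "C' = Pow W" by simp
    qed
  qed
  note key = this
  show ?thesis
    unfolding clique_decomposition_def
  proof (intro equalityI subsetI)
    fix S assume "S \<in> skeleton1 `
      {C \<in> clique_simplices m D. \<forall>C'\<in>clique_simplices m D. C \<subseteq> C' \<longrightarrow> C' = C}"
    then obtain C where C: "S = skeleton1 C" "C \<in> clique_simplices m D"
      "\<forall>C'\<in>clique_simplices m D. C \<subseteq> C' \<longrightarrow> C' = C" by auto
    moreover from C(2) obtain W where "C = Pow W" using pow by blast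
    ultimately show "S \<in> {skeleton1 (Pow W) | W. maximal_clique {1..m} (adj D) W \<and> 2 \<le> card W}"
      using key[of W] by auto
  next
    fix S assume "S \<in> {skeleton1 (Pow W) | W. maximal_clique {1..m} (adj D) W \<and> 2 \<le> card W}"
    then obtain W where S: "S = skeleton1 (Pow W)"
      and W: "maximal_clique {1..m} (adj D) W \<and> 2 \<le> card W" by auto
    from iffD2[OF key W] show "S \<in> skeleton1 `
      {C \<in> clique_simplices m D. \<forall>C'\<in>clique_simplices m D. C \<subseteq> C' \<longrightarrow> C' = C}"
      unfolding S by (intro imageI) simp
  qed
qed


section \<open>Lcm-closedness as a condition on forks\<close>

lemma lead_monos_coprime_iff: "mono_coprime (diag a b) (diag c d) \<longleftrightarrow> a \<noteq> c \<and> b \<noteq> d"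
  by (auto simp: mono_coprime_def keys_diag)

lemma diag_dvd_lcm_iff:
  "mono_dvd (diag e f) (mono_lcm (diag a b) (diag c d)) \<longleftrightarrow> (e = a \<or> e = c) \<and> (f = b \<or> f = d)"
  by (auto simp: diag_dvd_iff lookup_mono_lcm lookup_diag split: if_splits)

lemma minor_in_clique_ideal_iff:
  assumes "W \<subseteq> {1..m}" "a \<noteq> b" "p = minor a b \<or> p = minor b a"
  shows "(p :: 'k::field poly) \<in> edge_ideal m (skeleton1 (Pow W)) \<longleftrightarrow> a \<in> W \<and> b \<in> W"
proof -
  have "\<Union>(skeleton1 (Pow W)) \<subseteq> {1..m}" using assms(1) by (auto simp: skeleton1_def)
  then have "(minor a b :: 'k poly) \<in> edge_ideal m (skeleton1 (Pow W)) \<longleftrightarrow> a \<in> W \<and> b \<in> W"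
    "(minor b a :: 'k poly) \<in> edge_ideal m (skeleton1 (Pow W)) \<longleftrightarrow> b \<in> W \<and> a \<in> W"
    using assms(2) assms(2)[symmetric]
      minor_in_edge_ideal_iff[of "skeleton1 (Pow W)" m, where 'k = 'k] by simp_all
  with assms(3) show ?thesis by metis
qed

text \<open>Were \<open>b\<close> and \<open>c\<close> not adjacent, a maximal clique through \<open>{a, b}\<close> would miss \<open>c\<close> and one
  through \<open>{a, c}\<close> would miss \<open>b\<close>. The minors of the two edges have leading monomials with the common
  factor \<open>x\<^sub>1\<^sub>a\<close> or \<open>x\<^sub>2\<^sub>a\<close>, and a leading monomial dividing their lcm belongs to an edge through \<open>b\<close>
  or \<open>c\<close>, which is not an edge of the intersection of the two cliques.\<close>

lemma lcm_closed_imp_joined: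
  assumes order: "term_order m lt" and D: "simplicial_complex {1..m} D"
    and closed: "lcm_closed TYPE('k::field) m lt D"
    and E: "adj D a b" "adj D a c" and "b \<noteq> c"
    and fork: "precedes lt a b \<and> precedes lt a c \<or> precedes lt b a \<and> precedes lt c a"
  shows "adj D b c"
proof (rule ccontr)
  assume nE: "\<not> adj D b c"
  have "\<Union>D \<subseteq> {1..m}" using D by (auto simp: simplicial_complex_def)
  then have V: "a \<in> {1..m}" "b \<in> {1..m}" "c \<in> {1..m}"
    using E adj_vertices by blast+
  have ne: "a \<noteq> b" "a \<noteq> c" using E by (auto simp: adj_def)
  have "is_clique (adj D) {a, b}" "is_clique (adj D) {a, c}"
    using E adj_sym by (auto simp: is_clique_def)
  note cliques = this
  obtain W1 where W1: "{a, b} \<subseteq> W1" "maximal_clique {1..m} (adj D) W1"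
    by (rule clique_extends_to_maximal[OF _ _ cliques(1), of "{1..m}"]) (use V in simp_all)
  obtain W2 where W2: "{a, c} \<subseteq> W2" "maximal_clique {1..m} (adj D) W2"
    by (rule clique_extends_to_maximal[OF _ _ cliques(2), of "{1..m}"]) (use V in simp_all)
  note W = W1 W2
  have sub: "W1 \<subseteq> {1..m}" "W2 \<subseteq> {1..m}" "W1 \<inter> W2 \<subseteq> {1..m}"
    using W by (auto simp: maximal_clique_def)
  have cl: "is_clique (adj D) W1" "is_clique (adj D) W2" using W by (simp_all add: maximal_clique_def)
  have out: "b \<notin> W2" "c \<notin> W1"
  proof -
    show "b \<notin> W2" using cl(2) W(3) nE \<open>b \<noteq> c\<close> unfolding is_clique_def by auto
    show "c \<notin> W1" using cl(1) W(1) nE \<open>b \<noteq> c\<close> unfolding is_clique_def by auto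
  qed
  have card: "2 \<le> card W1" "2 \<le> card W2"
    using card_mono[OF finite_subset[OF sub(1)] W(1)] card_mono[OF finite_subset[OF sub(2)] W(3)] ne
    by auto
  obtain p where p: "p \<in> (minors m :: 'k poly set)" "p = minor a b \<or> p = minor b a"
    using minors_unorient[OF V(1,2) ne(1)] by blast
  obtain q where q: "q \<in> (minors m :: 'k poly set)" "q = minor a c \<or> q = minor c a"
    using minors_unorient[OF V(1,3) ne(2)] by blast
  have lead: "lead_mono lt p = diag a b \<and> lead_mono lt q = diag a c \<or>
      lead_mono lt p = diag b a \<and> lead_mono lt q = diag c a"
    using fork p(2) q(2) lead_mono_minor[OF order V(1,2), where 'k = 'k]
      lead_mono_minor[OF order V(1,3), where 'k = 'k]
      lead_mono_minor[OF order V(2,1), where 'k = 'k]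
      lead_mono_minor[OF order V(3,1), where 'k = 'k] by metis
  have dec: "skeleton1 (Pow W1) \<in> clique_decomposition m D"
      "skeleton1 (Pow W2) \<in> clique_decomposition m D"
    using W card clique_decomposition_eq[OF D] by auto
  have "p \<in> edge_ideal m (skeleton1 (Pow W1))" "q \<in> edge_ideal m (skeleton1 (Pow W2))"
    "p \<notin> edge_ideal m (skeleton1 (Pow W1) \<inter> skeleton1 (Pow W2))"
    "q \<notin> edge_ideal m (skeleton1 (Pow W1) \<inter> skeleton1 (Pow W2))"
    unfolding skeleton1_Pow_Int
      minor_in_clique_ideal_iff[OF sub(1) ne(1) p(2)] minor_in_clique_ideal_iff[OF sub(2) ne(2) q(2)]
      minor_in_clique_ideal_iff[OF sub(3) ne(1) p(2)] minor_in_clique_ideal_iff[OF sub(3) ne(2) q(2)]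
    using W out by auto
  moreover have "\<not> mono_coprime (lead_mono lt p) (lead_mono lt q)"
    using lead lead_monos_coprime_iff by metis
  ultimately obtain r :: "'k poly" where r: "r \<in> minors m"
      "r \<in> edge_ideal m (skeleton1 (Pow W1) \<inter> skeleton1 (Pow W2))"
      "mono_dvd (lead_mono lt r) (mono_lcm (lead_mono lt p) (lead_mono lt q))"
    using closed dec p(1) q(1) unfolding lcm_closed_def by blast
  obtain e f where ef: "e \<noteq> f" "r = minor e f \<or> r = minor f e" "lead_mono lt r = diag e f"
    using minors_orient[OF order r(1)] by metis
  have "e \<in> W1 \<inter> W2" "f \<in> W1 \<inter> W2"
    using r(2) minor_in_clique_ideal_iff[OF sub(3) ef(1,2)] by (simp_all add: skeleton1_Pow_Int)
  moreover have "e = b \<or> e = c \<or> f = b \<or> f = c"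
    using r(3) ef(3) lead by (auto simp: diag_dvd_lcm_iff)
  ultimately show False using out by auto
qed

text \<open>In a closed graph the premises in the definition of lcm-closedness are contradictory: minors
  with non-coprime leading monomials share an endpoint, and if neither edge lies in both cliques,
  their other endpoints lie in one clique each, which the crossing lemma forbids.\<close>

lemma lcm_closed_iff_fork_closed:
  assumes order: "term_order m lt" and D: "simplicial_complex {1..m} D"
  shows "lcm_closed TYPE('k::field) m lt D \<longleftrightarrow>
    fork_closed (precedes lt) (adj D) \<and> fork_closed (precedes lt)\<inverse>\<inverse> (adj D)"
proof
  assume "lcm_closed TYPE('k) m lt D"
  from lcm_closed_imp_joined[OF order D this]
  show "fork_closed (precedes lt) (adj D) \<and> fork_closed (precedes lt)\<inverse>\<inverse> (adj D)"
    unfolding fork_closed_def conversep_iff by blast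
next
  assume closed: "fork_closed (precedes lt) (adj D) \<and> fork_closed (precedes lt)\<inverse>\<inverse> (adj D)"
  note lin = precedes_strict_linear_order[OF order]
  have dual: "transp_on {1..m} (precedes lt)\<inverse>\<inverse>" "totalp_on {1..m} (precedes lt)\<inverse>\<inverse>"
    using lin(2,3) by (auto simp: totalp_on_def)
  show "lcm_closed TYPE('k) m lt D"
    unfolding lcm_closed_def
  proof (intro ballI impI, elim conjE)
    fix D1 D2 and p q :: "'k poly"
    assume dec: "D1 \<in> clique_decomposition m D" "D2 \<in> clique_decomposition m D"
      and p: "p \<in> minors m \<inter> edge_ideal m D1" and q: "q \<in> minors m \<inter> edge_ideal m D2"
      and nc: "\<not> mono_coprime (lead_mono lt p) (lead_mono lt q)"
      and out: "p \<notin> edge_ideal m (D1 \<inter> D2)" "q \<notin> edge_ideal m (D1 \<inter> D2)"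
    obtain W1 W2 where W: "D1 = skeleton1 (Pow W1)" "maximal_clique {1..m} (adj D) W1"
        "D2 = skeleton1 (Pow W2)" "maximal_clique {1..m} (adj D) W2"
      using dec unfolding clique_decomposition_eq[OF D] by auto
    have sub: "W1 \<subseteq> {1..m}" "W2 \<subseteq> {1..m}" "W1 \<inter> W2 \<subseteq> {1..m}"
      using W by (auto simp: maximal_clique_def)
    obtain a b where ab: "precedes lt a b" "a \<noteq> b" "p = minor a b \<or> p = minor b a"
        "lead_mono lt p = diag a b"
      using minors_orient[OF order, of p] p by (metis IntD1)
    obtain c d where cd: "precedes lt c d" "c \<noteq> d" "q = minor c d \<or> q = minor d c"
        "lead_mono lt q = diag c d"
      using minors_orient[OF order, of q] q by (metis IntD1)
    have p_in: "a \<in> W1" "b \<in> W1"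
      using p minor_in_clique_ideal_iff[OF sub(1) ab(2,3)] by (auto simp: W)
    have q_in: "c \<in> W2" "d \<in> W2"
      using q minor_in_clique_ideal_iff[OF sub(2) cd(2,3)] by (auto simp: W)
    have p_out: "\<not> (a \<in> W2 \<and> b \<in> W2)"
      using out(1) minor_in_clique_ideal_iff[OF sub(3) ab(2,3)] p_in by (auto simp: W skeleton1_Pow_Int)
    have q_out: "\<not> (c \<in> W1 \<and> d \<in> W1)"
      using out(2) minor_in_clique_ideal_iff[OF sub(3) cd(2,3)] q_in by (auto simp: W skeleton1_Pow_Int)
    from nc consider "a = c" | "b = d" by (auto simp: ab(4) cd(4) lead_monos_coprime_iff)
    then have False
    proof cases
      case 1
      then show False
        using fork_closed_no_crossing_cliques[OF lin(2,3) adj_sym _ _ W(2) W(4), of a b d]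
          closed p_in q_in p_out q_out ab(1) cd(1) by auto
    next
      case 2
      then show False
        using fork_closed_no_crossing_cliques[OF dual adj_sym _ _ W(2) W(4), of b a c]
          closed p_in q_in p_out q_out ab(1) cd(1) by auto
    qed
    then show "\<exists>r\<in>minors m \<inter> edge_ideal m (D1 \<inter> D2).
        mono_dvd (lead_mono lt r) (mono_lcm (lead_mono lt p) (lead_mono lt q))" ..
  qed
qed


section \<open>Rewriting monomials along edges\<close>

text \<open>One reduction step of a monomial modulo the generators: the leading term of a minor is
  replaced by its other term. Since minors are pure differences, no coefficients are involved.\<close>

definition swap_step :: "(mono \<Rightarrow> mono \<Rightarrow> bool) \<Rightarrow> nat set set \<Rightarrow> mono \<Rightarrow> mono \<Rightarrow> bool" where
  "swap_step lt D s t \<longleftrightarrow>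
     (\<exists>a b u. adj D a b \<and> precedes lt a b \<and> s = u + diag a b \<and> t = u + diag b a)"

lemma swap_stepI: "adj D a b \<Longrightarrow> precedes lt a b \<Longrightarrow> swap_step lt D (u + diag a b) (u + diag b a)"
  unfolding swap_step_def by blast

lemma swap_step_translate: "swap_step lt D s t \<Longrightarrow> swap_step lt D (u + s) (u + t)"
proof -
  assume "swap_step lt D s t"
  then obtain a b v where st: "adj D a b" "precedes lt a b" "s = v + diag a b" "t = v + diag b a"
    by (auto simp: swap_step_def)
  show ?thesis
    unfolding st(3,4) add.assoc[symmetric] using st(1,2) by (rule swap_stepI)
qed

lemma swap_step_less:
  assumes order: "term_order m lt" and D: "\<Union>D \<subseteq> {1..m}"
    and "swap_step lt D s t" "s \<in> monomials m"
  shows "t \<in> monomials m \<and> lt t s"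
proof -
  obtain a b u where st: "adj D a b" "precedes lt a b" "s = u + diag a b" "t = u + diag b a"
    using assms(3) by (auto simp: swap_step_def)
  have V: "a \<in> {1..m}" "b \<in> {1..m}" using adj_vertices[OF D st(1)] by auto
  have "Poly_Mapping.keys u \<subseteq> Poly_Mapping.keys s" by (auto simp: st(3) in_keys_iff lookup_add)
  then have u: "u \<in> monomials m" using assms(4) by (auto simp: monomials_def)
  have "lt (diag b a + u) (diag a b + u)"
    using order u st(2) diag_in_monomials[OF V] diag_in_monomials[OF V(2,1)]
    unfolding term_order_def precedes_def by blast
  then show ?thesis
    using u monomials_add diag_in_monomials[OF V(2,1)] by (simp add: st(3,4) add.commute)
qed

lemma swap_steps_less:
  assumes order: "term_order m lt" and D: "\<Union>D \<subseteq> {1..m}"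
    and "(swap_step lt D)\<^sup>*\<^sup>* s t" "s \<in> monomials m"
  shows "t \<in> monomials m \<and> (t = s \<or> lt t s)"
  using assms(3,4)
proof (induction rule: rtranclp_induct)
  case (step t t')
  then have t: "t \<in> monomials m" "t = s \<or> lt t s" by auto
  then have "t' \<in> monomials m" "lt t' t" using swap_step_less[OF order D step(2)] by auto
  moreover have "transp_on (monomials m) lt" using order by (simp add: term_order_def)
  ultimately show ?case using t step.prems by (metis transp_onD)
qed simp

lemma single_dvd_iff: "mono_dvd (Poly_Mapping.single v 1) t \<longleftrightarrow> 1 \<le> Poly_Mapping.lookup t v"
  by (cases v) (auto simp: mono_dvd_iff lookup_single when_def)

text \<open>Two steps at edges \<open>{a, b}\<close> and \<open>{c, d}\<close> that use disjoint variables commute. If they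
  share only \<open>x\<^sub>1\<^sub>a\<close>, the two results differ by exchanging \<open>x\<^sub>1\<^sub>b x\<^sub>2\<^sub>d\<close> for \<open>x\<^sub>1\<^sub>d x\<^sub>2\<^sub>b\<close>; as \<open>{b, d}\<close> is an
  edge by closedness, one result reduces to the other in one step, and likewise if they share only \<open>x\<^sub>2\<^sub>b\<close>. No
  diverging pair needs more than one step on either side to join.\<close>

lemma swap_step_confluent:
  assumes order: "term_order m lt" and D: "\<Union>D \<subseteq> {1..m}"
    and closed: "fork_closed (precedes lt) (adj D)" "fork_closed (precedes lt)\<inverse>\<inverse> (adj D)"
  shows "strong_confluentp (swap_step lt D)"
proof
  fix x y z assume "swap_step lt D x y" "swap_step lt D x z"
  then obtain a b u c d v where
    ab: "adj D a b" "precedes lt a b" "x = u + diag a b" "y = u + diag b a" and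
    cd: "adj D c d" "precedes lt c d" "x = v + diag c d" "z = v + diag d c"
    unfolding swap_step_def by blast
  have eq: "u + diag a b = v + diag c d" using ab cd by simp
  then have look: "Poly_Mapping.lookup (u + diag a b) w = Poly_Mapping.lookup (v + diag c d) w" for w
    by simp
  have V: "a \<in> {1..m}" "b \<in> {1..m}" "c \<in> {1..m}" "d \<in> {1..m}"
    using adj_vertices[OF D ab(1)] adj_vertices[OF D cd(1)] by auto
  \<comment> \<open>For an edge, one of the two orientations of the exchange lowers the monomial.\<close>
  have one: "swap_step lt D (w + diag e f) (w + diag f e) \<or> swap_step lt D (w + diag f e) (w + diag e f)"
    if "adj D e f" for e f w
  proof -
    have "precedes lt e f \<or> precedes lt f e"
      using precedes_strict_linear_order(3)[OF order] adj_vertices[OF D that] that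
      by (auto simp: totalp_on_def adj_def)
    then show ?thesis using swap_stepI that adj_sym by metis
  qed
  have "y = z \<or> swap_step lt D y z \<or> swap_step lt D z y \<or>
      (\<exists>w. swap_step lt D y w \<and> swap_step lt D z w)"
  proof (cases "a = c"; cases "b = d")
    assume "a = c" "b = d"
    then show ?thesis using ab cd by simp
  next
    assume ne: "a = c" "b \<noteq> d"
    then have "1 \<le> Poly_Mapping.lookup u (2, d)"
      using look[of "(2, d)"] by (simp add: lookup_add lookup_diag)
    then obtain w where w: "u = Poly_Mapping.single (2, d) 1 + w"
      unfolding single_dvd_iff[symmetric] mono_dvd_def by blast
    have "v + diag c d = (Poly_Mapping.single (2, b) 1 + w) + diag c d"
      unfolding eq[symmetric] w ne by (simp add: diag_def ac_simps)
    then have v: "v = Poly_Mapping.single (2, b) 1 + w" by (rule add_right_imp_eq)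
    have "adj D b d" using fork_closedD[OF closed(1)] ab cd ne by blast
    moreover have "y = (w + Poly_Mapping.single (2, a) 1) + diag b d"
      "z = (w + Poly_Mapping.single (2, a) 1) + diag d b"
      unfolding ab(4) cd(4) w v ne by (simp_all add: diag_def ac_simps)
    ultimately show ?thesis using one by metis
  next
    assume ne: "a \<noteq> c" "b = d"
    then have "1 \<le> Poly_Mapping.lookup u (1, c)"
      using look[of "(1, c)"] by (simp add: lookup_add lookup_diag)
    then obtain w where w: "u = Poly_Mapping.single (1, c) 1 + w"
      unfolding single_dvd_iff[symmetric] mono_dvd_def by blast
    have "v + diag c d = (Poly_Mapping.single (1, a) 1 + w) + diag c d"
      unfolding eq[symmetric] w ne by (simp add: diag_def ac_simps)
    then have v: "v = Poly_Mapping.single (1, a) 1 + w" by (rule add_right_imp_eq)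
    have "adj D a c"
      using fork_closedD[OF closed(2), of b a c] ab cd ne adj_sym by (metis conversep_iff)
    moreover have "y = (w + Poly_Mapping.single (1, b) 1) + diag c a"
      "z = (w + Poly_Mapping.single (1, b) 1) + diag a c"
      unfolding ab(4) cd(4) w v ne by (simp_all add: diag_def ac_simps)
    ultimately show ?thesis using one by metis
  next
    assume ne: "a \<noteq> c" "b \<noteq> d"
    then have "mono_dvd (diag c d) u"
      using look[of "(1, c)"] look[of "(2, d)"]
      by (simp add: diag_dvd_iff lookup_add lookup_diag)
    then obtain w where w: "u = diag c d + w" unfolding mono_dvd_def by blast
    have "v + diag c d = (diag a b + w) + diag c d"
      unfolding eq[symmetric] w by (simp add: ac_simps)
    then have v: "v = diag a b + w" by (rule add_right_imp_eq)
    have "y = (w + diag b a) + diag c d" "z = (w + diag d c) + diag a b"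
      "(w + diag b a) + diag d c = (w + diag d c) + diag b a"
      unfolding ab(4) cd(4) w v by (simp_all add: ac_simps)
    then show ?thesis using swap_stepI ab(1,2) cd(1,2) by metis
  qed
  then show "\<exists>w. (swap_step lt D)\<^sup>*\<^sup>* y w \<and> (swap_step lt D)\<^sup>=\<^sup>= z w"
    by (metis (full_types) r_into_rtranclp rtranclp.rtrancl_refl sup2CI)
qed


section \<open>Groebner bases of binomial edge ideals\<close>

lemma edge_minor_orient:
  assumes "term_order m lt" "\<Union>D \<subseteq> {1..m}" "g \<in> (edge_minors D :: 'k::field poly set)"
  obtains a b where "adj D a b" "precedes lt a b" "lead_mono lt g = diag a b"
proof -
  obtain c d where cd: "g = minor c d" "c < d" "{c, d} \<in> D"
    using assms(3) by (auto simp: edge_minors_def)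
  then have V: "c \<in> {1..m}" "d \<in> {1..m}" "c \<noteq> d" using assms(2) by auto
  then consider "precedes lt c d" | "precedes lt d c"
    using precedes_strict_linear_order(3)[OF assms(1)] by (metis totalp_onD)
  then show thesis
  proof cases
    case 1
    then show thesis
      using that[of c d] cd V(3) lead_mono_minor(1)[OF assms(1) V(1,2) 1] by (simp add: adj_def)
  next
    case 2
    then show thesis
      using that[of d c] cd V(3) lead_mono_minor(2)[OF assms(1) V(2,1) 2]
      by (simp add: adj_def insert_commute)
  qed
qed

lemma edge_minor_exists:
  assumes "term_order m lt" "\<Union>D \<subseteq> {1..m}" "adj D a b" "precedes lt a b"
  shows "\<exists>g\<in>(edge_minors D :: 'k::field poly set). lead_mono lt g = diag a b"
proof -
  have V: "a \<in> {1..m}" "b \<in> {1..m}" using adj_vertices[OF assms(2,3)] by auto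
  show ?thesis
  proof (cases "a < b")
    case True
    then have "(minor a b :: 'k poly) \<in> edge_minors D"
      using assms(3) by (auto simp: edge_minors_def adj_def)
    then show ?thesis using lead_mono_minor(1)[OF assms(1) V assms(4)] by blast
  next
    case False
    then have "b < a" "{b, a} \<in> D" using assms(3) by (auto simp: adj_def insert_commute)
    then have "(minor b a :: 'k poly) \<in> edge_minors D" by (auto simp: edge_minors_def)
    then show ?thesis using lead_mono_minor(2)[OF assms(1) V assms(4)] by blast
  qed
qed

lemma groebner_basis_edge_minors_iff:
  assumes order: "term_order m lt" and D: "\<Union>D \<subseteq> {1..m}"
  shows "groebner_basis m lt (edge_minors D) (edge_ideal m D :: 'k::field poly set) \<longleftrightarrow>
    (\<forall>f\<in>edge_ideal m D - {0 :: 'k poly}.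
       \<exists>a b. adj D a b \<and> precedes lt a b \<and> mono_dvd (diag a b) (lead_mono lt f))"
proof -
  note carr = edge_minors_carrier[OF D, where 'k = 'k]
  have "(edge_minors D :: 'k poly set) \<subseteq> (\<lambda>(a, b). minor a b) ` ({1..m} \<times> {1..m})"
    using D by (auto simp: edge_minors_def)
  then have fin: "finite (edge_minors D :: 'k poly set)" by (rule finite_subset) simp
  have nz: "0 \<notin> (edge_minors D :: 'k poly set)"
  proof
    assume "0 \<in> (edge_minors D :: 'k poly set)"
    then obtain a b where "a < b" "minor a b = (0 :: 'k poly)" by (auto simp: edge_minors_def)
    then show False using keys_minor[of a b, where 'k = 'k] by simp
  qed
  have sub: "(edge_minors D :: 'k poly set) \<subseteq> edge_ideal m D"
    unfolding edge_ideal_def by (rule genideal_poly_ring_self[OF carr])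
  have I: "edge_ideal m D \<subseteq> carrier (poly_ring m :: 'k poly ring)"
    unfolding edge_ideal_def by (rule genideal_poly_ring_carrier[OF carr])
  have "(\<exists>g\<in>(edge_minors D :: 'k poly set). mono_dvd (lead_mono lt g) t) \<longleftrightarrow>
      (\<exists>a b. adj D a b \<and> precedes lt a b \<and> mono_dvd (diag a b) t)" for t
    using edge_minor_orient[OF order D] edge_minor_exists[OF order D, where 'k = 'k] by metis
  then show ?thesis
    unfolding groebner_basis_iff_lead_mono_dvd[OF order fin sub nz I] by simp
qed

text \<open>The row \<open>i\<close> is the one in which the leading monomials of the two minors do not meet:
  multiplying by \<open>x\<^sub>i\<^sub>b\<close> and \<open>x\<^sub>i\<^sub>c\<close> makes these leading terms equal. They cancel in the S-polynomial
  \<open>x\<^sub>i\<^sub>b [a, c] - x\<^sub>i\<^sub>c [a, b] = x\<^sub>i\<^sub>a [b, c]\<close>. A leading monomial of an edge dividing one of the two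
  monomials on the right either comes from \<open>{b, c}\<close> or involves \<open>x\<^sub>i\<^sub>a\<close>; the latter would put \<open>a\<close> on
  the wrong side of \<open>b\<close> or \<open>c\<close>.\<close>

lemma groebner_basis_imp_joined:
  assumes order: "term_order m lt" and D: "\<Union>D \<subseteq> {1..m}"
    and gb: "groebner_basis m lt (edge_minors D) (edge_ideal m D :: 'k::field poly set)"
    and E: "adj D a b" "adj D a c" and "b \<noteq> c"
    and fork: "i = (2::nat) \<and> precedes lt a b \<and> precedes lt a c \<or>
      i = 1 \<and> precedes lt b a \<and> precedes lt c a"
  shows "adj D b c"
proof (rule ccontr)
  assume nE: "\<not> adj D b c"
  note carr = edge_minors_carrier[OF D, where 'k = 'k]
  have V: "a \<in> {1..m}" "b \<in> {1..m}" "c \<in> {1..m}"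
    using adj_vertices[OF D E(1)] adj_vertices[OF D E(2)] by auto
  have asym: "\<not> (precedes lt e f \<and> precedes lt f e)" if "e \<in> {1..m}" "f \<in> {1..m}" for e f
    using precedes_strict_linear_order(1,2)[OF order] that by (meson irreflp_onD transp_onD)
  let ?f = "X i a * minor b c :: 'k poly"
  have mem: "q * minor e f \<in> edge_ideal m D"
    if "adj D e f" "q \<in> carrier (poly_ring m)" for e f and q :: "'k poly"
    using that minor_in_edge_ideal_iff[OF D, of e f, where 'k = 'k]
      genideal_poly_ring_mult[OF carr] by (auto simp: edge_ideal_def adj_def)
  have "X i b * minor a c + (- X i c) * minor a b \<in> (edge_ideal m D :: 'k poly set)"
    unfolding edge_ideal_def
    by (rule genideal_poly_ring_add[OF carr]; fold edge_ideal_def; rule mem[OF E(2)] mem[OF E(1)])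
       (use fork V in \<open>auto simp: poly_ring_def X_def monomials_def\<close>)
  also have "X i b * minor a c + (- X i c) * minor a b = ?f"
    using fork by (auto simp: minor_def algebra_simps)
  finally have f: "?f \<in> edge_ideal m D" .
  have "?f = Poly_Mapping.single (Poly_Mapping.single (i, a) 1 + diag b c) 1 -
      Poly_Mapping.single (Poly_Mapping.single (i, a) 1 + diag c b) 1"
    by (simp add: X_def minor_eq right_diff_distrib mult_single)
  then have keys: "Poly_Mapping.keys ?f =
      {Poly_Mapping.single (i, a) 1 + diag b c, Poly_Mapping.single (i, a) 1 + diag c b}"
    using \<open>b \<noteq> c\<close> by (auto simp: in_keys_iff lookup_minus lookup_single when_def split: if_splits)
  then have "?f \<noteq> 0" by auto
  have "Poly_Mapping.keys ?f \<subseteq> monomials m"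
    using f genideal_poly_ring_carrier[OF carr] by (auto simp: edge_ideal_def poly_ring_def)
  from lead_mono_greatest(1)[OF order this \<open>?f \<noteq> 0\<close>]
  have lead: "lead_mono lt ?f = Poly_Mapping.single (i, a) 1 + diag b c \<or>
      lead_mono lt ?f = Poly_Mapping.single (i, a) 1 + diag c b"
    unfolding keys by simp
  obtain e g where eg: "adj D e g" "precedes lt e g" "mono_dvd (diag e g) (lead_mono lt ?f)"
    using gb f \<open>?f \<noteq> 0\<close> unfolding groebner_basis_edge_minors_iff[OF order D] by blast
  have dvd: "(e = x \<or> i = 1 \<and> e = a) \<and> (g = y \<or> i = 2 \<and> g = a)"
    if "mono_dvd (diag e g) (Poly_Mapping.single (i, a) 1 + diag x y)" for x y
    using that unfolding diag_dvd_iff lookup_add lookup_diag lookup_single when_def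
    by (simp split: if_splits)
  have "e = b \<and> g = c \<or> e = c \<and> g = b \<or> i = 1 \<and> e = a \<and> (g = b \<or> g = c) \<or>
      i = 2 \<and> g = a \<and> (e = b \<or> e = c)" (is "?edge1 \<or> ?edge2 \<or> ?row1 \<or> ?row2")
    using lead
  proof
    assume "lead_mono lt ?f = Poly_Mapping.single (i, a) 1 + diag b c"
    with eg(3) show ?thesis using dvd[of b c] eg(1) by (auto simp: adj_def)
  next
    assume "lead_mono lt ?f = Poly_Mapping.single (i, a) 1 + diag c b"
    with eg(3) show ?thesis using dvd[of c b] eg(1) by (auto simp: adj_def)
  qed
  then consider ?edge1 | ?edge2 | ?row1 | ?row2 by blast
  then show False
  proof cases
    case 1
    with eg(1) nE show False by simp
  next
    case 2
    with eg(1) nE adj_sym show False by blast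
  next
    case 3
    then show False using fork eg(2) asym[OF V(1,2)] asym[OF V(1,3)] by auto
  next
    case 4
    then show False using fork eg(2) asym[OF V(1,2)] asym[OF V(1,3)] by auto
  qed
qed

text \<open>If the leading monomial \<open>t\<close> of \<open>f\<close> were irreducible, confluence would make the set of
  monomials reducing to \<open>t\<close> closed under steps in both directions. Summing the coefficients of \<open>f\<close>
  over this set would then give zero. But every monomial reducing to \<open>t\<close> is at least \<open>t\<close>, so only
  the coefficient of \<open>t\<close> itself would contribute.\<close>

lemma fork_closed_imp_groebner_basis:
  assumes order: "term_order m lt" and D: "\<Union>D \<subseteq> {1..m}"
    and closed: "fork_closed (precedes lt) (adj D)" "fork_closed (precedes lt)\<inverse>\<inverse> (adj D)"
  shows "groebner_basis m lt (edge_minors D) (edge_ideal m D :: 'k::field poly set)"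
  unfolding groebner_basis_edge_minors_iff[OF order D]
proof (intro ballI, rule ccontr)
  note carr = edge_minors_carrier[OF D, where 'k = 'k]
  fix f :: "'k poly" assume f: "f \<in> edge_ideal m D - {0}"
  define t where "t = lead_mono lt f"
  assume "\<not> (\<exists>a b. adj D a b \<and> precedes lt a b \<and> mono_dvd (diag a b) (lead_mono lt f))"
  then have irreducible: "\<not> swap_step lt D t t'" for t'
    unfolding swap_step_def t_def mono_dvd_def by (metis add.commute)
  have keys: "Poly_Mapping.keys f \<subseteq> monomials m"
    using f genideal_poly_ring_carrier[OF carr] by (auto simp: edge_ideal_def poly_ring_def)
  have lead: "t \<in> Poly_Mapping.keys f" "\<And>s. s \<in> Poly_Mapping.keys f \<Longrightarrow> s \<noteq> t \<Longrightarrow> lt s t"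
    using lead_mono_greatest[OF order keys] f by (auto simp: t_def)
  define F :: "mono \<Rightarrow> 'k" where "F s = (if (swap_step lt D)\<^sup>*\<^sup>* s t then 1 else 0)" for s
  have confl: "semiconfluentp (swap_step lt D)"
    by (rule strong_confluentp_into_semiconfluentp[OF swap_step_confluent[OF order D closed]])
  have F: "F s = F s'" if step: "swap_step lt D s s'" for s s'
  proof -
    have "(swap_step lt D)\<^sup>*\<^sup>* s' t" if reach: "(swap_step lt D)\<^sup>*\<^sup>* s t"
    proof -
      obtain w where "(swap_step lt D)\<^sup>*\<^sup>* s' w" "(swap_step lt D)\<^sup>*\<^sup>* t w"
        using semiconfluentpD[OF confl step reach] by blast
      moreover from this(2) have "w = t"
        by (rule converse_rtranclpE) (use irreducible in auto)
      ultimately show ?thesis by simp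
    qed
    then show ?thesis
      using converse_rtranclp_into_rtranclp[of "swap_step lt D", OF step] by (auto simp: F_def)
  qed
  have "weighted_sum F f = 0"
  proof (rule weighted_sum_genideal_eq_zero[OF _ carr])
    show "f \<in> Idl\<^bsub>poly_ring m\<^esub> (edge_minors D)" using f by (simp add: edge_ideal_def)
  next
    fix s :: "'k poly" and F :: "mono \<Rightarrow> 'k"
    assume s: "s \<in> edge_minors D" and inv: "\<And>t t'. swap_step lt D t t' \<Longrightarrow> F t = F t'"
    then obtain a b where ab: "s = minor a b" "adj D a b"
      by (auto simp: edge_minors_def adj_def)
    have "precedes lt a b \<or> precedes lt b a"
      using precedes_strict_linear_order(3)[OF order] adj_vertices[OF D ab(2)] ab(2)
      by (auto simp: totalp_on_def adj_def)
    then have "F (diag a b) = F (diag b a)"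
      using inv swap_stepI[of D a b lt 0] swap_stepI[of D b a lt 0] ab(2) adj_sym by auto
    then show "weighted_sum F s = 0" by (simp add: ab(1) weighted_sum_minor)
  qed (use swap_step_translate F in auto)
  moreover have "weighted_sum F f = (\<Sum>s\<in>{t}. Poly_Mapping.lookup f s * F s)"
    unfolding weighted_sum_def
  proof (rule sum.mono_neutral_right)
    show "\<forall>s\<in>Poly_Mapping.keys f - {t}. Poly_Mapping.lookup f s * F s = 0"
    proof
      fix s assume s: "s \<in> Poly_Mapping.keys f - {t}"
      then have mono: "s \<in> monomials m" "t \<in> monomials m" and "lt s t"
        using keys lead by auto
      have "\<not> lt t s"
        using order mono \<open>lt s t\<close> unfolding term_order_def by (meson irreflp_onD transp_onD)
      then have "\<not> (swap_step lt D)\<^sup>*\<^sup>* s t"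
        using swap_steps_less[OF order D _ mono(1)] s by blast
      then show "Poly_Mapping.lookup f s * F s = 0" by (simp add: F_def)
    qed
  qed (use lead in auto)
  ultimately have "Poly_Mapping.lookup f t = 0" by (simp add: F_def)
  with lead(1) show False by (simp add: in_keys_iff)
qed

lemma groebner_basis_iff_fork_closed:
  assumes order: "term_order m lt" and D: "\<Union>D \<subseteq> {1..m}"
  shows "groebner_basis m lt (edge_minors D) (edge_ideal m D :: 'k::field poly set) \<longleftrightarrow>
    fork_closed (precedes lt) (adj D) \<and> fork_closed (precedes lt)\<inverse>\<inverse> (adj D)"
proof
  assume "groebner_basis m lt (edge_minors D) (edge_ideal m D :: 'k poly set)"
  from groebner_basis_imp_joined[OF order D this]
  show "fork_closed (precedes lt) (adj D) \<and> fork_closed (precedes lt)\<inverse>\<inverse> (adj D)"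
    unfolding fork_closed_def conversep_iff by blast
qed (use fork_closed_imp_groebner_basis[OF order D] in blast)

lemma edge_minors_reduced:
  assumes order: "term_order m lt" and D: "\<Union>D \<subseteq> {1..m}"
    and "g \<in> (edge_minors D :: 'k::field poly set)" "h \<in> edge_minors D" "g \<noteq> h"
    and "t \<in> Poly_Mapping.keys h"
  shows "\<not> mono_dvd (lead_mono lt g) t"
proof -
  obtain a b c d where g: "g = minor a b" "a < b" "{a, b} \<in> D" and h: "h = minor c d" "c < d"
    using assms(3,4) by (auto simp: edge_minors_def)
  have "Poly_Mapping.keys g \<subseteq> monomials m" "g \<noteq> 0"
    using edge_minors_carrier[OF D, where 'k = 'k] assms(3) keys_minor[of a b, where 'k = 'k] g
    by (auto simp: poly_ring_def)
  from lead_mono_greatest(1)[OF order this]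
  have "lead_mono lt g = diag a b \<or> lead_mono lt g = diag b a"
    using g by (simp add: keys_minor)
  moreover have "t = diag c d \<or> t = diag d c" using assms(6) h by (simp add: keys_minor)
  moreover have "\<not> (a = c \<and> b = d)" using assms(5) g h by auto
  ultimately show ?thesis using g(2) h(2) by (auto simp: diag_dvd_diag_iff)
qed

theorem proposition2p19:
  fixes m :: nat and lt :: "mono \<Rightarrow> mono \<Rightarrow> bool" and \<Delta> :: "nat set set"
  assumes "m \<ge> 2"
    and "term_order m lt"
    and "simplicial_complex {1..m} \<Delta>"
    and "pure_of_dim 1 \<Delta>"
  shows "reduced_groebner_basis m lt (edge_minors \<Delta>) (edge_ideal m \<Delta> :: 'k::field poly set)
    \<longleftrightarrow> lcm_closed TYPE('k) m lt \<Delta>"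
proof -
  have D: "\<Union>\<Delta> \<subseteq> {1..m}" using assms(3) by (auto simp: simplicial_complex_def)
  have "reduced_groebner_basis m lt (edge_minors \<Delta>) (edge_ideal m \<Delta> :: 'k poly set)
      \<longleftrightarrow> groebner_basis m lt (edge_minors \<Delta>) (edge_ideal m \<Delta> :: 'k poly set)"
    using edge_minors_reduced[OF assms(2) D] unfolding reduced_groebner_basis_def by blast
  then show ?thesis
    by (simp only: groebner_basis_iff_fork_closed[OF assms(2) D]
        lcm_closed_iff_fork_closed[OF assms(2,3)])
qed

end
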